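(* Any $G$-martingale $\{M_t\}_{t\in[0,T]}$ has a quasi-continuous version.
   Context: Sublinear expectations. Let $\mathcal{H}$ be a linear space of real functions on a set $\Omega$ containing the constants. A sublinear expectation on $\mathcal{H}$ is a functional $\hat{E}:\mathcal{H}\to\mathbb{R}$ that is monotone, satisfies $\hat{E}(c)=c$ for constants $c$, $\hat{E}(X)-\hat{E}(Y)\le\hat{E}(X-Y)$, and $\hat{E}(\lambda X)=\lambda\hat{E}(X)$ for $\lambda\ge 0$. $C_{l,Lip}(\mathbb{R}^n)$ is the set of $\varphi:\mathbb{R}^n\to\mathbb{R}$ with $|\varphi(x)-\varphi(y)|\le C(1+|x|^k+|y|^k)|x-y|$ for some $C,k$ depending on $\varphi$. Random vectors $X_1,X_2$ (on possibly different sublinear expectation spaces, with sublinear expectations $\hat{E}_1,\hat{E}_2$) are identically distributed, $X_1\sim X_2$, if $\hat{E}_1[\varphi(X_1)]=\hat{E}_2[\varphi(X_2)]$ for all $\varphi\in C_{l,Lip}$. $Y$ is independent to $X$ if $\hat{E}[\varphi(X,Y)]=\hat{E}[\hat{E}[\varphi(x,Y)]_{x=X}]$ for all $\varphi\in C_{l,Lip}$. A $d$-dimensional $X$ is $G$-normal distributed if $aX+b\hat{X}\sim\sqrt{a^2+b^2}\,X$ for all $a,b\in\mathbb{R}$, where $\hat{X}$ is an independent copy of $X$; here $G(A):=\frac12\hat{E}[(AX,X)]$ for $A$ in the space $S_d$ of symmetric $d\times d$ matrices. One has $G(A)=\frac12\sup_{\gamma\in\Gamma}\mathrm{Tr}(\gamma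 A)$ for a bounded, convex, closed set $\Gamma$ of nonnegative symmetric matrices. Standing assumption (non-degeneracy): there is $\beta_0>0$ with $G(A)-G(B)\ge\beta_0\mathrm{Tr}(A-B)$ whenever $A\ge B$. $G$-expectation. $\Omega_T=C_0([0,T];\mathbb{R}^d)$ (continuous paths starting at $0$) with the supremum norm, $B_t(\omega)=\omega_t$ is the canonical process ($G$-Brownian motion), and $$\mathcal{H}^0_T=\{\varphi(B_{t_1},\dots,B_{t_n}): n\ge1,\ t_1,\dots,t_n\in[0,T],\ \varphi\in C_{l,Lip}(\mathbb{R}^{d\times n})\}.$$ The $G$-expectation is the sublinear expectation on $\mathcal{H}^0_T$ given, for $0=t_0<t_1<\dots<t_m\le T$, by $$\hat{E}[\varphi(B_{t_1}-B_{t_0},\dots,B_{t_m}-B_{t_{m-1}})]=\tilde{E}[\varphi(\sqrt{t_1-t_0}\,\xi_1,\dots,\sqrt{t_m-t_{m-1}}\,\xi_m)],$$ where $\xi_1,\dots,\xi_m$ are identically distributed $G$-normal $d$-dimensional vectors (with the given function $G$) on a sublinear expectation space with sublinear expectation $\tilde{E}$, and $\xi_{i+1}$ is independent to $(\xi_1,\dots,\xi_i)$ for each $i$. The conditional expectation is $\hat{E}_{t_i}[\varphi(B_{t_1}-B_{t_0},\dots,B_{t_m}-B_{t_{m-1}})]=\tilde\varphi(B_{t_1}-B_{t_0},\dots,B_{t_i}-B_{t_{i-1}})$ with $\tilde\varphi(x_1,\dots,x_i)=\hat{E}[\varphi(x_1,\dots,x_i,B_{t_{i+1}}-B_{t_i},\dots,B_{t_m}-B_{t_{m-1}})]$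 (any time $t\in[0,T]$ may be inserted into the partition). $L^1_G(\Omega_T)$ is the completion of $\mathcal{H}^0_T$ under $\|\xi\|_{1,G}=\hat{E}(|\xi|)$, and $\hat{E}$, $\hat{E}_t$ extend continuously to it. It is known that there is a weakly compact set $\mathcal{P}$ of Borel probability measures on $\Omega_T$ with $\hat{E}(\xi)=\max_{P\in\mathcal{P}}E_P(\xi)$ on $\mathcal{H}^0_T$; the capacity is $c(A)=\sup_{P\in\mathcal{P}}P(A)$ (it does not depend on the choice of weakly compact $\mathcal{P}$), and "q.s." means outside a set of capacity $c$ zero. Elements of $L^1_G(\Omega_T)$ are regarded as measurable functions on $\Omega_T$ up to q.s. equality. Processes. A process $\{M_t\}_{t\in[0,T]}$ with values in $L^1_G(\Omega_T)$ is a $G$-martingale if $\hat{E}_s(M_t)=M_s$ for all $s\le t$. A process $\{X_t\}$ is a version of $\{Y_t\}$ if $X_t=Y_t$ q.s. for every $t\in[0,T]$. A process $\{M_t\}$ with values in $L^1_G(\Omega_T)$ is quasi-continuous if for every $\varepsilon>0$ there is an open set $O\subset\Omega_T$ with $c(O)<\varepsilon$ such that $(\omega,t)\mapsto M_t(\omega)$ is continuous on $O^c\times[0,T]$. *)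

theory Defs
  imports "HOL-Probability.Probability"
begin

section \<open>Sublinear expectations\<close>

text \<open>
  The number of components of the random vectors varies inside the definitions below, so a vector
  with \<open>n\<close> components in \<open>'v\<close> is a function \<open>nat \<Rightarrow> 'v\<close> of which only the values at
  \<open>0, \<dots>, n - 1\<close> matter.  With \<open>'v = real ^ 'd\<close> this is the space of
  \<open>d \<times> n\<close>-dimensional vectors.
\<close>

definition vnorm :: "nat \<Rightarrow> (nat \<Rightarrow> 'v::real_normed_vector) \<Rightarrow> real"
  where "vnorm n x = L2_set (\<lambda>i. norm (x i)) {..<n}"

definition vjoin :: "nat \<Rightarrow> (nat \<Rightarrow> 'v) \<Rightarrow> (nat \<Rightarrow> 'v) \<Rightarrow> nat \<Rightarrow> 'v"
  where "vjoin m x y = (\<lambda>i. if i < m then x i else y (i - m))"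

text \<open>
  The estimate forces a member of \<open>C_lLip n\<close> to depend only on the first \<open>n\<close> components.
\<close>

definition C_lLip :: "nat \<Rightarrow> ((nat \<Rightarrow> 'v::real_normed_vector) \<Rightarrow> real) set"
  where "C_lLip n = {\<phi>. \<exists>(C::real) (k::nat). \<forall>x y.
    \<bar>\<phi> x - \<phi> y\<bar> \<le> C * (1 + vnorm n x ^ k + vnorm n y ^ k) * vnorm n (\<lambda>i. x i - y i)}"

text \<open>
  \<open>\<Omega>\<close> is a carrier: only the values on \<open>\<Omega>\<close> of the functions in \<open>H\<close> are relevant, and
  monotonicity makes \<open>E\<close> respect equality on \<open>\<Omega>\<close>.  The values of \<open>E\<close> outside \<open>H\<close> are
  meaningless.
\<close>

definition sublinear_expectation ::
  "'w set \<Rightarrow> ('w \<Rightarrow> real) set \<Rightarrow> (('w \<Rightarrow> real) \<Rightarrow> real) \<Rightarrow> bool"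
  where "sublinear_expectation \<Omega> H E \<longleftrightarrow>
    (\<forall>c. (\<lambda>_. c) \<in> H) \<and>
    (\<forall>X\<in>H. \<forall>Y\<in>H. (\<lambda>\<omega>. X \<omega> + Y \<omega>) \<in> H) \<and>
    (\<forall>c. \<forall>X\<in>H. (\<lambda>\<omega>. c * X \<omega>) \<in> H) \<and>
    (\<forall>X\<in>H. \<forall>Y\<in>H. (\<forall>\<omega>\<in>\<Omega>. X \<omega> \<le> Y \<omega>) \<longrightarrow> E X \<le> E Y) \<and>
    (\<forall>c. E (\<lambda>_. c) = c) \<and>
    (\<forall>X\<in>H. \<forall>Y\<in>H. E X - E Y \<le> E (\<lambda>\<omega>. X \<omega> - Y \<omega>)) \<and>
    (\<forall>c\<ge>0. \<forall>X\<in>H. E (\<lambda>\<omega>. c * X \<omega>) = c * E X)"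

text \<open>
  A random vector with \<open>n\<close> components: every expectation \<open>E[\<phi>(X)]\<close> with \<open>\<phi>\<close> in
  \<open>C_lLip n\<close> makes sense.
\<close>

definition random_vector ::
  "('w \<Rightarrow> real) set \<Rightarrow> nat \<Rightarrow> (nat \<Rightarrow> 'w \<Rightarrow> 'v::real_normed_vector) \<Rightarrow> bool"
  where "random_vector H n X \<longleftrightarrow> (\<forall>\<phi>\<in>C_lLip n. (\<lambda>\<omega>. \<phi> (\<lambda>i. X i \<omega>)) \<in> H)"

definition identically_distributed ::
  "('w \<Rightarrow> real) set \<Rightarrow> (('w \<Rightarrow> real) \<Rightarrow> real) \<Rightarrow>
   ('u \<Rightarrow> real) set \<Rightarrow> (('u \<Rightarrow> real) \<Rightarrow> real) \<Rightarrow>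
   nat \<Rightarrow> (nat \<Rightarrow> 'w \<Rightarrow> 'v::real_normed_vector) \<Rightarrow> (nat \<Rightarrow> 'u \<Rightarrow> 'v) \<Rightarrow> bool"
  where "identically_distributed H1 E1 H2 E2 n X1 X2 \<longleftrightarrow>
    random_vector H1 n X1 \<and> random_vector H2 n X2 \<and>
    (\<forall>\<phi>\<in>C_lLip n. E1 (\<lambda>\<omega>. \<phi> (\<lambda>i. X1 i \<omega>)) = E2 (\<lambda>\<omega>. \<phi> (\<lambda>i. X2 i \<omega>)))"

text \<open>\<open>Y\<close> (with \<open>n\<close> components) is independent to \<open>X\<close> (with \<open>m\<close> components).\<close>

definition independent_to ::
  "('w \<Rightarrow> real) set \<Rightarrow> (('w \<Rightarrow> real) \<Rightarrow> real) \<Rightarrow>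
   nat \<Rightarrow> (nat \<Rightarrow> 'w \<Rightarrow> 'v::real_normed_vector) \<Rightarrow> nat \<Rightarrow> (nat \<Rightarrow> 'w \<Rightarrow> 'v) \<Rightarrow> bool"
  where "independent_to H E n Y m X \<longleftrightarrow>
    random_vector H (m + n) (\<lambda>i \<omega>. vjoin m (\<lambda>j. X j \<omega>) (\<lambda>j. Y j \<omega>) i) \<and>
    (\<forall>\<phi>\<in>C_lLip (m + n).
      E (\<lambda>\<omega>. \<phi> (vjoin m (\<lambda>j. X j \<omega>) (\<lambda>j. Y j \<omega>))) =
      E (\<lambda>\<omega>. E (\<lambda>\<omega>'. \<phi> (vjoin m (\<lambda>j. X j \<omega>) (\<lambda>j. Y j \<omega>')))))"


section \<open>\<open>G\<close>-normal vectors\<close>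

text \<open>
  The joint distribution of \<open>X\<close> and an independent copy of it is determined by the distribution
  of \<open>X\<close>, so which independent copy is used is irrelevant.
\<close>

definition G_normal ::
  "('w \<Rightarrow> real) set \<Rightarrow> (('w \<Rightarrow> real) \<Rightarrow> real) \<Rightarrow> (real ^ 'd ^ 'd \<Rightarrow> real) \<Rightarrow>
   ('w \<Rightarrow> real ^ 'd::finite) \<Rightarrow> bool"
  where "G_normal H E G X \<longleftrightarrow>
    random_vector H 1 (\<lambda>_. X) \<and>
    (\<exists>X'. identically_distributed H E H E 1 (\<lambda>_. X') (\<lambda>_. X) \<and>
          independent_to H E 1 (\<lambda>_. X') 1 (\<lambda>_. X) \<and>
          (\<forall>a b::real. identically_distributed H E H E 1
              (\<lambda>_ \<omega>. a *\<^sub>R X \<omega> + b *\<^sub>R X' \<omega>)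
              (\<lambda>_ \<omega>. sqrt (a\<^sup>2 + b\<^sup>2) *\<^sub>R X \<omega>))) \<and>
    (\<forall>A. transpose A = A \<longrightarrow> G A = 1 / 2 * E (\<lambda>\<omega>. (A *v X \<omega>) \<bullet> X \<omega>))"

definition iid_G_normal_sequence ::
  "('w \<Rightarrow> real) set \<Rightarrow> (('w \<Rightarrow> real) \<Rightarrow> real) \<Rightarrow> (real ^ 'd ^ 'd \<Rightarrow> real) \<Rightarrow>
   (nat \<Rightarrow> 'w \<Rightarrow> real ^ 'd::finite) \<Rightarrow> bool"
  where "iid_G_normal_sequence H E G \<xi> \<longleftrightarrow>
    (\<forall>i. G_normal H E G (\<xi> i)) \<and>
    (\<forall>i j. identically_distributed H E H E 1 (\<lambda>_. \<xi> i) (\<lambda>_. \<xi> j)) \<and>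
    (\<forall>i. independent_to H E 1 (\<lambda>_. \<xi> (Suc i)) (Suc i) \<xi>)"

definition nondegenerate :: "(real ^ 'd ^ 'd \<Rightarrow> real) \<Rightarrow> bool"
  where "nondegenerate G \<longleftrightarrow>
    (\<exists>\<beta>>0. \<forall>A B :: real ^ 'd ^ 'd::finite.
      transpose A = A \<longrightarrow> transpose B = B \<longrightarrow> (\<forall>x. 0 \<le> ((A - B) *v x) \<bullet> x) \<longrightarrow>
      G A - G B \<ge> \<beta> * trace (A - B))"


section \<open>Path space and \<open>G\<close>-expectation\<close>

text \<open>
  A path on \<open>[0, T]\<close> is represented by its extension to the real line that is constant on
  \<open>t \<le> 0\<close> and on \<open>t \<ge> T\<close>.  On such paths the norm of bounded continuous functions is the
  supremum norm over \<open>[0, T]\<close>.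
\<close>

type_synonym 'd path = "(real, real ^ 'd) bcontfun"

definition path_space :: "real \<Rightarrow> 'd::finite path set"
  where "path_space T = {\<omega>. apply_bcontfun \<omega> 0 = 0 \<and>
    (\<forall>t. apply_bcontfun \<omega> t = apply_bcontfun \<omega> (max 0 (min T t)))}"

text \<open>The canonical process (\<open>G\<close>-Brownian motion).\<close>

abbreviation BM :: "real \<Rightarrow> 'd::finite path \<Rightarrow> real ^ 'd"
  where "BM t \<omega> \<equiv> apply_bcontfun \<omega> t"

definition H0 :: "real \<Rightarrow> ('d::finite path \<Rightarrow> real) set"
  where "H0 T = {X. \<exists>n\<ge>1. \<exists>t. (\<forall>i<n. t i \<in> {0..T}) \<and>
    (\<exists>\<phi>\<in>C_lLip n. \<forall>\<omega>\<in>path_space T. X \<omega> = \<phi> (\<lambda>i. BM (t i) \<omega>))}"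

text \<open>The points \<open>0 = t 0 < \<dots> < t m \<le> T\<close>; the values of \<open>t\<close> beyond \<open>m\<close> are irrelevant.\<close>

definition time_partition :: "real \<Rightarrow> nat \<Rightarrow> (nat \<Rightarrow> real) \<Rightarrow> bool"
  where "time_partition T m t \<longleftrightarrow>
    1 \<le> m \<and> t 0 = 0 \<and> (\<forall>i<m. t i < t (Suc i)) \<and> t m \<le> T"

definition increments :: "(nat \<Rightarrow> real) \<Rightarrow> 'd::finite path \<Rightarrow> nat \<Rightarrow> real ^ 'd"
  where "increments t \<omega> = (\<lambda>i. BM (t (Suc i)) \<omega> - BM (t i) \<omega>)"

definition G_expectation ::
  "('w \<Rightarrow> real) set \<Rightarrow> (('w \<Rightarrow> real) \<Rightarrow> real) \<Rightarrow> (nat \<Rightarrow> 'w \<Rightarrow> real ^ 'd::finite) \<Rightarrow>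
   real \<Rightarrow> (('d path \<Rightarrow> real) \<Rightarrow> real) \<Rightarrow> bool"
  where "G_expectation H' E' \<xi> T E \<longleftrightarrow>
    sublinear_expectation (path_space T) (H0 T) E \<and>
    (\<forall>m t. time_partition T m t \<longrightarrow> (\<forall>\<phi>\<in>C_lLip m.
      E (\<lambda>\<omega>. \<phi> (increments t \<omega>)) =
      E' (\<lambda>w. \<phi> (\<lambda>i. sqrt (t (Suc i) - t i) *\<^sub>R \<xi> i w))))"

text \<open>
  \<open>cond_cylinder T E s X Y\<close>: for \<open>X = \<phi>(increments)\<close> in \<open>H0 T\<close>, with \<open>s\<close> one of the
  points of the partition, \<open>Y\<close> is the conditional expectation of \<open>X\<close> at time \<open>s\<close>.
\<close>

definition cond_cylinder ::
  "real \<Rightarrow> (('d::finite path \<Rightarrow> real) \<Rightarrow> real) \<Rightarrow> real \<Rightarrow>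
   ('d path \<Rightarrow> real) \<Rightarrow> ('d path \<Rightarrow> real) \<Rightarrow> bool"
  where "cond_cylinder T E s X Y \<longleftrightarrow>
    (\<exists>m t i. \<exists>\<phi>\<in>C_lLip m. time_partition T m t \<and> i \<le> m \<and> t i = s \<and>
      (\<forall>\<omega>\<in>path_space T.
        X \<omega> = \<phi> (increments t \<omega>) \<and>
        Y \<omega> = E (\<lambda>\<omega>'. \<phi> (\<lambda>j. if j < i then increments t \<omega> j else increments t \<omega>' j))))"


section \<open>Representing measures and capacity\<close>

definition borel_prob_measures :: "'a::topological_space set \<Rightarrow> 'a measure set"
  where "borel_prob_measures \<Omega> =
    {P. prob_space P \<and> sets P = sets (restrict_space borel \<Omega>)}"

definition weak_topology :: "'a::topological_space set \<Rightarrow> 'a measure topology"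
  where "weak_topology \<Omega> = topology_generated_by
    {{P \<in> borel_prob_measures \<Omega>. (\<integral>\<omega>. f \<omega> \<partial>P) \<in> U} | (f::'a \<Rightarrow> real) U.
      continuous_on \<Omega> f \<and> bounded (f ` \<Omega>) \<and> open U}"

definition represents ::
  "real \<Rightarrow> 'd::finite path measure set \<Rightarrow> (('d path \<Rightarrow> real) \<Rightarrow> real) \<Rightarrow> bool"
  where "represents T \<P> E \<longleftrightarrow>
    compactin (weak_topology (path_space T)) \<P> \<and>
    (\<forall>X\<in>H0 T. (\<forall>P\<in>\<P>. integrable P X \<and> (\<integral>\<omega>. X \<omega> \<partial>P) \<le> E X) \<and>
               (\<exists>P\<in>\<P>. (\<integral>\<omega>. X \<omega> \<partial>P) = E X))"

definition capacity :: "'a measure set \<Rightarrow> 'a set \<Rightarrow> ennreal"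
  where "capacity \<P> A = (SUP P\<in>\<P>. emeasure P A)"

definition qs_eq ::
  "real \<Rightarrow> 'd::finite path measure set \<Rightarrow> ('d path \<Rightarrow> real) \<Rightarrow> ('d path \<Rightarrow> real) \<Rightarrow> bool"
  where "qs_eq T \<P> X Y \<longleftrightarrow>
    (\<exists>A \<in> sets (restrict_space borel (path_space T)). capacity \<P> A = 0 \<and>
      (\<forall>\<omega> \<in> path_space T - A. X \<omega> = Y \<omega>))"

text \<open>
  On \<open>H0 T\<close>, \<open>norm1 \<P> X\<close> is the \<open>G\<close>-expectation of \<open>\<bar>X\<bar>\<close>.  The space of measurable
  functions with finite \<open>norm1\<close>, modulo quasi-sure equality, is complete, so the completion of
  \<open>H0 T\<close>, viewed as a space of measurable functions up to quasi-sure equality, is the closure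
  of \<open>H0 T\<close> among the measurable functions.
\<close>

definition norm1 :: "'a measure set \<Rightarrow> ('a \<Rightarrow> real) \<Rightarrow> ennreal"
  where "norm1 \<P> X = (SUP P\<in>\<P>. \<integral>\<^sup>+\<omega>. ennreal \<bar>X \<omega>\<bar> \<partial>P)"

definition L1G :: "real \<Rightarrow> 'd::finite path measure set \<Rightarrow> ('d path \<Rightarrow> real) set"
  where "L1G T \<P> = {X \<in> borel_measurable (restrict_space borel (path_space T)).
    \<exists>\<xi>. (\<forall>n. \<xi> n \<in> H0 T) \<and> (\<lambda>n. norm1 \<P> (\<lambda>\<omega>. \<xi> n \<omega> - X \<omega>)) \<longlonglongrightarrow> 0}"

text \<open>
  The continuous extension of the conditional expectation, as a relation:
  \<open>Y\<close> is (up to quasi-sure equality) the conditional expectation of \<open>X\<close> at time \<open>s\<close>.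
\<close>

definition cond_expectation ::
  "real \<Rightarrow> (('d::finite path \<Rightarrow> real) \<Rightarrow> real) \<Rightarrow> 'd path measure set \<Rightarrow> real \<Rightarrow>
   ('d path \<Rightarrow> real) \<Rightarrow> ('d path \<Rightarrow> real) \<Rightarrow> bool"
  where "cond_expectation T E \<P> s X Y \<longleftrightarrow>
    X \<in> L1G T \<P> \<and> Y \<in> L1G T \<P> \<and>
    (\<exists>\<xi> \<eta>. (\<forall>n. cond_cylinder T E s (\<xi> n) (\<eta> n)) \<and>
      (\<lambda>n. norm1 \<P> (\<lambda>\<omega>. \<xi> n \<omega> - X \<omega>)) \<longlonglongrightarrow> 0 \<and>
      (\<lambda>n. norm1 \<P> (\<lambda>\<omega>. \<eta> n \<omega> - Y \<omega>)) \<longlonglongrightarrow> 0)"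


section \<open>Processes\<close>

definition L1G_process ::
  "real \<Rightarrow> 'd::finite path measure set \<Rightarrow> (real \<Rightarrow> 'd path \<Rightarrow> real) \<Rightarrow> bool"
  where "L1G_process T \<P> M \<longleftrightarrow> (\<forall>t\<in>{0..T}. M t \<in> L1G T \<P>)"

definition G_martingale ::
  "real \<Rightarrow> (('d::finite path \<Rightarrow> real) \<Rightarrow> real) \<Rightarrow> 'd path measure set \<Rightarrow>
   (real \<Rightarrow> 'd path \<Rightarrow> real) \<Rightarrow> bool"
  where "G_martingale T E \<P> M \<longleftrightarrow>
    L1G_process T \<P> M \<and>
    (\<forall>s\<in>{0..T}. \<forall>t\<in>{0..T}. s \<le> t \<longrightarrow> cond_expectation T E \<P> s (M t) (M s))"

definition version_of ::
  "real \<Rightarrow> 'd::finite path measure set \<Rightarrow> (real \<Rightarrow> 'd path \<Rightarrow> real) \<Rightarrow>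
   (real \<Rightarrow> 'd path \<Rightarrow> real) \<Rightarrow> bool"
  where "version_of T \<P> X Y \<longleftrightarrow> (\<forall>t\<in>{0..T}. qs_eq T \<P> (X t) (Y t))"

definition quasi_continuous ::
  "real \<Rightarrow> 'd::finite path measure set \<Rightarrow> (real \<Rightarrow> 'd path \<Rightarrow> real) \<Rightarrow> bool"
  where "quasi_continuous T \<P> M \<longleftrightarrow>
    L1G_process T \<P> M \<and>
    (\<forall>\<epsilon>>0. \<exists>U. openin (top_of_set (path_space T)) U \<and> capacity \<P> U < ennreal \<epsilon> \<and>
      continuous_on ((path_space T - U) \<times> {0..T}) (\<lambda>(\<omega>, t). M t \<omega>))"

end

theory Submission
  imports Defs
begin

text \<open>
  For a cylinder function \<open>X\<close>, the conditional expectation at time \<open>s\<close> is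
  \<open>\<omega> \<mapsto> E (\<omega>' \<mapsto> X (pconcat s \<omega> \<omega>'))\<close>, where \<open>pconcat s \<omega> \<omega>'\<close> follows \<open>\<omega>\<close> up to
  time \<open>s\<close> and then the increments of \<open>\<omega>'\<close>; the tower property thus becomes associativity of
  concatenation together with \<open>E (E\<^sub>s X) = E X\<close>, which is the independence of the increments.
  When \<open>X\<close> is Lipschitz, this expression is jointly continuous in \<open>(\<omega>, s)\<close>, because
  the expectation of \<open>|B\<^sub>u - B\<^sub>v|\<close> is a multiple of the square root of \<open>|u - v|\<close>.
  A weak-type maximal inequality bounds the capacity of the open set where \<open>sup\<^sub>s E\<^sub>s X > c\<close> by
  \<open>2 E X / c\<close> for \<open>X \<ge> 0\<close>.  Approximating \<open>M\<^sub>T\<close> by Lipschitz cylinder functions \<open>\<zeta>\<^sub>k\<close> geometrically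
  fast, the continuous processes \<open>E\<^sub>t \<zeta>\<^sub>k\<close> converge uniformly in \<open>t\<close> outside open sets of small
  capacity, and their limit is the required version.
\<close>

section \<open>Functions of polynomial growth and sublinear expectations\<close>

text \<open>The convergence must be uniform in t outside an open set, and M_T is only in L^1_G, so
  the tool has to be an L^1 maximal inequality that holds for all P in \<open>\<P>\<close> at once.
  Its classical proof is blocked twice: stopping leads out of the cylinder functions, where alone E
  is meaningful, and a sublinear E is not additive. What survives is E(a X + b) = a E(X) + b for
  constants a >= 0 and b; hence only martingale transforms with nonnegative weights known at the
  conditioning time are used. The weights begin to drop at c/2 instead of c, which is the origin of
  the factor 2. It suffices to approximate the terminal value: conditional expectations contract the
  L^1 norm, so \<open>cexp E t (\<zeta> k)\<close> approaches M_t for every t at one and the same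
  rate. The exceptional sets are open by continuity, being unions over t of preimages of open
  half-lines. The rates are 4^-k for the norms and 2^-k for the thresholds, so that the capacities,
  which are bounded by the ratio, are summable as well.\<close>

lemma vnorm_nonneg [simp]: "0 \<le> vnorm n x"
  by (simp add: vnorm_def)

lemma norm_le_vnorm: "i < n \<Longrightarrow> norm (x i) \<le> vnorm n x"
  unfolding vnorm_def by (rule member_le_L2_set) auto

lemma vnorm_le_sum: "vnorm n x \<le> (\<Sum>i<n. norm (x i))"
  unfolding vnorm_def by (rule L2_set_le_sum) auto

lemma vnorm_le_bound:
  assumes "\<And>i. i < n \<Longrightarrow> norm (x i) \<le> K"
  shows "vnorm n x \<le> n * K"
proof -
  have "(\<Sum>i<n. norm (x i)) \<le> (\<Sum>i<n. K)"
    using assms by (intro sum_mono) auto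
  then show ?thesis using vnorm_le_sum[of n x] by simp
qed

lemma vnorm_cong: "(\<And>i. i < n \<Longrightarrow> x i = y i) \<Longrightarrow> vnorm n x = vnorm n y"
  unfolding vnorm_def by (rule L2_set_cong) auto

lemma vnorm_zero [simp]: "vnorm n (\<lambda>_. 0) = 0"
  by (simp add: vnorm_def L2_set_def)

lemma vnorm_triangle: "vnorm n (\<lambda>i. x i + y i) \<le> vnorm n x + vnorm n y"
proof -
  have "vnorm n (\<lambda>i. x i + y i) \<le> L2_set (\<lambda>i. norm (x i) + norm (y i)) {..<n}"
    unfolding vnorm_def by (intro L2_set_mono) (auto simp: norm_triangle_ineq)
  also have "\<dots> \<le> vnorm n x + vnorm n y"
    unfolding vnorm_def by (rule L2_set_triangle_ineq)
  finally show ?thesis .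
qed

lemma vnorm_diff: "\<bar>vnorm n x - vnorm n y\<bar> \<le> vnorm n (\<lambda>i. x i - y i)"
proof -
  have "vnorm n (\<lambda>i. y i - x i) = vnorm n (\<lambda>i. x i - y i)"
    unfolding vnorm_def by (simp add: norm_minus_commute)
  then show ?thesis
    using vnorm_triangle[of n "\<lambda>i. x i - y i" y] vnorm_triangle[of n "\<lambda>i. y i - x i" x] by simp
qed

lemma vnorm_vjoin: "vnorm (m + n) (vjoin m x y) \<le> vnorm m x + vnorm n y"
proof -
  have "(\<Sum>i<m + n. (norm (vjoin m x y i))\<^sup>2) = (\<Sum>i<m. (norm (x i))\<^sup>2) + (\<Sum>i<n. (norm (y i))\<^sup>2)"
    by (simp add: lessThan_atLeast0 sum.atLeastLessThan_concat[of 0 m "m + n", symmetric]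
        vjoin_def sum.shift_bounds_nat_ivl[of _ 0 m n, simplified add.commute[of n m], simplified])
  then have "vnorm (m + n) (vjoin m x y) = sqrt ((vnorm m x)\<^sup>2 + (vnorm n y)\<^sup>2)"
    by (simp add: vnorm_def L2_set_def sum_nonneg)
  then show ?thesis by (simp add: sqrt_sum_squares_le_sum)
qed

text \<open>A single power of 1 + |x| + |y| replaces the sum of powers in \<open>C_lLip\<close>:
  such factors multiply and compare by monotonicity, which the closure properties below rely
  on.\<close>

lemma C_lLipI:
  assumes "0 \<le> C"
    and "\<And>x y. \<bar>\<phi> x - \<phi> y\<bar> \<le> C * (1 + vnorm n x + vnorm n y) ^ k * vnorm n (\<lambda>i. x i - y i)"
  shows "\<phi> \<in> C_lLip n"
proof -
  have *: "(1 + a + b) ^ k \<le> 3 ^ k * (1 + a ^ k + b ^ k)" if "0 \<le> a" "0 \<le> b" for a b :: real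
  proof -
    \<comment> \<open>Each of 1, a and b is at most c, and c ^ k is one of 1, a ^ k, b ^ k.\<close>
    define c where "c = max 1 (max a b)"
    have "(1 + a + b) ^ k \<le> (3 * c) ^ k"
      using that by (intro power_mono) (auto simp: c_def)
    also have "\<dots> = 3 ^ k * c ^ k" by (simp add: power_mult_distrib)
    also have "c ^ k \<le> 1 + a ^ k + b ^ k"
      using that by (auto simp: c_def max_def)
    finally show ?thesis by simp
  qed
  have "\<bar>\<phi> x - \<phi> y\<bar> \<le> (C * 3 ^ k) * (1 + vnorm n x ^ k + vnorm n y ^ k) * vnorm n (\<lambda>i. x i - y i)" for x y
  proof -
    have "C * (1 + vnorm n x + vnorm n y) ^ k * vnorm n (\<lambda>i. x i - y i)
       \<le> C * (3 ^ k * (1 + vnorm n x ^ k + vnorm n y ^ k)) * vnorm n (\<lambda>i. x i - y i)"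
      using assms(1) by (intro mult_right_mono mult_left_mono *) auto
    with assms(2)[of x y] show ?thesis by (simp add: mult.assoc)
  qed
  then show ?thesis unfolding C_lLip_def by blast
qed

lemma C_lLipE:
  assumes "\<phi> \<in> C_lLip n"
  obtains C k where "0 \<le> C"
    "\<And>x y. \<bar>\<phi> x - \<phi> y\<bar> \<le> C * (1 + vnorm n x + vnorm n y) ^ k * vnorm n (\<lambda>i. x i - y i)"
proof -
  obtain C k where Ck: "\<And>x y. \<bar>\<phi> x - \<phi> y\<bar> \<le> C * (1 + vnorm n x ^ k + vnorm n y ^ k) * vnorm n (\<lambda>i. x i - y i)"
    using assms unfolding C_lLip_def by blast
  have *: "1 + a ^ k + b ^ k \<le> 3 * (1 + a + b) ^ k" if "0 \<le> a" "0 \<le> b" for a b :: real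
  proof -
    have "1 ^ k \<le> (1 + a + b) ^ k" "a ^ k \<le> (1 + a + b) ^ k" "b ^ k \<le> (1 + a + b) ^ k"
      using that by (auto intro!: power_mono simp del: power_one)
    then show ?thesis by simp
  qed
  have "\<bar>\<phi> x - \<phi> y\<bar> \<le> (3 * \<bar>C\<bar>) * (1 + vnorm n x + vnorm n y) ^ k * vnorm n (\<lambda>i. x i - y i)" for x y
  proof -
    have "C * (1 + vnorm n x ^ k + vnorm n y ^ k) * vnorm n (\<lambda>i. x i - y i)
       \<le> \<bar>C\<bar> * (3 * (1 + vnorm n x + vnorm n y) ^ k) * vnorm n (\<lambda>i. x i - y i)"
      by (intro mult_right_mono mult_mono *) auto
    with Ck[of x y] show ?thesis by (simp add: mult_ac)
  qed
  then show ?thesis using that[of "3 * \<bar>C\<bar>" k] by simp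
qed

lemma C_lLip_cong_arg:
  assumes "\<phi> \<in> C_lLip n" "\<And>i. i < n \<Longrightarrow> x i = y i"
  shows "\<phi> x = \<phi> y"
proof -
  obtain C k where "\<And>x y. \<bar>\<phi> x - \<phi> y\<bar> \<le> C * (1 + vnorm n x + vnorm n y) ^ k * vnorm n (\<lambda>i. x i - y i)"
    using C_lLipE[OF assms(1)] by metis
  moreover have "vnorm n (\<lambda>i. x i - y i) = vnorm n (\<lambda>_. 0 :: 'a)"
    using assms(2) by (intro vnorm_cong) auto
  ultimately have "\<bar>\<phi> x - \<phi> y\<bar> \<le> 0" by (metis mult_zero_right vnorm_zero)
  then show ?thesis by simp
qed

lemma C_lLip_const [simp]: "(\<lambda>_. c) \<in> C_lLip n"
  by (rule C_lLipI[of 0 _ _ 0]) auto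

lemma C_lLip_norm: "i < n \<Longrightarrow> (\<lambda>x. norm (x i)) \<in> C_lLip n"
proof (rule C_lLipI[of 1 _ _ 0])
  fix x y :: "nat \<Rightarrow> 'a" assume "i < n"
  then have "norm (x i - y i) \<le> vnorm n (\<lambda>i. x i - y i)" using norm_le_vnorm[of i n "\<lambda>i. x i - y i"] by simp
  then show "\<bar>norm (x i) - norm (y i)\<bar> \<le> 1 * (1 + vnorm n x + vnorm n y) ^ 0 * vnorm n (\<lambda>i. x i - y i)"
    using norm_triangle_ineq3[of "x i" "y i"] by simp
qed auto

lemma C_lLip_vnorm: "vnorm n \<in> C_lLip n"
  by (rule C_lLipI[of 1 _ _ 0]) (auto simp: vnorm_diff)

lemma C_lLip_lipschitz:
  assumes "\<phi> \<in> C_lLip n" "0 \<le> K" "\<And>a b. \<bar>f a - f b\<bar> \<le> K * \<bar>a - b\<bar>"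
  shows "(\<lambda>x. f (\<phi> x)) \<in> C_lLip n"
proof -
  obtain C k where C: "0 \<le> C" "\<And>x y. \<bar>\<phi> x - \<phi> y\<bar> \<le> C * (1 + vnorm n x + vnorm n y) ^ k * vnorm n (\<lambda>i. x i - y i)"
    using C_lLipE[OF assms(1)] by metis
  show ?thesis
  proof (rule C_lLipI[of "K * C" _ _ k])
    fix x y
    have "\<bar>f (\<phi> x) - f (\<phi> y)\<bar> \<le> K * \<bar>\<phi> x - \<phi> y\<bar>" by (rule assms)
    also have "\<dots> \<le> K * (C * (1 + vnorm n x + vnorm n y) ^ k * vnorm n (\<lambda>i. x i - y i))"
      by (intro mult_left_mono C assms)
    finally show "\<bar>f (\<phi> x) - f (\<phi> y)\<bar> \<le> K * C * (1 + vnorm n x + vnorm n y) ^ k * vnorm n (\<lambda>i. x i - y i)"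
      by (simp add: mult.assoc)
  qed (use assms C in auto)
qed

lemma C_lLip_add:
  assumes "\<phi> \<in> C_lLip n" "\<psi> \<in> C_lLip n"
  shows "(\<lambda>x. \<phi> x + \<psi> x) \<in> C_lLip n"
proof -
  obtain C k where C: "0 \<le> C" "\<And>x y. \<bar>\<phi> x - \<phi> y\<bar> \<le> C * (1 + vnorm n x + vnorm n y) ^ k * vnorm n (\<lambda>i. x i - y i)"
    using C_lLipE[OF assms(1)] by metis
  obtain D l where D: "0 \<le> D" "\<And>x y. \<bar>\<psi> x - \<psi> y\<bar> \<le> D * (1 + vnorm n x + vnorm n y) ^ l * vnorm n (\<lambda>i. x i - y i)"
    using C_lLipE[OF assms(2)] by metis
  show ?thesis
  proof (rule C_lLipI[of "C + D" _ _ "k + l"])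
    fix x y :: "nat \<Rightarrow> 'a"
    let ?v = "vnorm n (\<lambda>i. x i - y i)" and ?w = "1 + vnorm n x + vnorm n y"
    have "\<bar>(\<phi> x + \<psi> x) - (\<phi> y + \<psi> y)\<bar> \<le> C * ?w ^ k * ?v + D * ?w ^ l * ?v"
      using C(2)[of x y] D(2)[of x y] by linarith
    also have "\<dots> \<le> C * ?w ^ (k + l) * ?v + D * ?w ^ (k + l) * ?v"
      using C(1) D(1) by (intro add_mono mult_right_mono mult_left_mono power_increasing) auto
    finally show "\<bar>(\<phi> x + \<psi> x) - (\<phi> y + \<psi> y)\<bar> \<le> (C + D) * ?w ^ (k + l) * ?v"
      by (simp add: algebra_simps)
  qed (use C D in auto)
qed

lemma C_lLip_growth:
  assumes "\<phi> \<in> C_lLip n"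
  obtains K k where "0 \<le> K" "\<And>x. \<bar>\<phi> x\<bar> \<le> K * (1 + vnorm n x) ^ k"
proof -
  obtain C k where C: "0 \<le> C" "\<And>x y. \<bar>\<phi> x - \<phi> y\<bar> \<le> C * (1 + vnorm n x + vnorm n y) ^ k * vnorm n (\<lambda>i. x i - y i)"
    using C_lLipE[OF assms(1)] by metis
  have "\<bar>\<phi> x\<bar> \<le> (\<bar>\<phi> (\<lambda>_. 0)\<bar> + C) * (1 + vnorm n x) ^ Suc k" for x
  proof -
    have "\<bar>\<phi> x\<bar> \<le> \<bar>\<phi> (\<lambda>_. 0)\<bar> * 1 + C * (1 + vnorm n x) ^ k * vnorm n x"
      using C(2)[of x "\<lambda>_. 0"] by simp
    also have "\<dots> \<le> \<bar>\<phi> (\<lambda>_. 0)\<bar> * (1 + vnorm n x) ^ Suc k + C * (1 + vnorm n x) ^ k * (1 + vnorm n x)"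
      using C(1) by (intro add_mono mult_left_mono one_le_power) auto
    finally show ?thesis by (simp add: algebra_simps)
  qed
  then show ?thesis using that[of "\<bar>\<phi> (\<lambda>_. 0)\<bar> + C" "Suc k"] C(1) by simp
qed

lemma C_lLip_mult:
  assumes "\<phi> \<in> C_lLip n" "\<psi> \<in> C_lLip n"
  shows "(\<lambda>x. \<phi> x * \<psi> x) \<in> C_lLip n"
proof -
  obtain C k where C: "0 \<le> C" "\<And>x y. \<bar>\<phi> x - \<phi> y\<bar> \<le> C * (1 + vnorm n x + vnorm n y) ^ k * vnorm n (\<lambda>i. x i - y i)"
    using C_lLipE[OF assms(1)] by metis
  obtain D l where D: "0 \<le> D" "\<And>x y. \<bar>\<psi> x - \<psi> y\<bar> \<le> D * (1 + vnorm n x + vnorm n y) ^ l * vnorm n (\<lambda>i. x i - y i)"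
    using C_lLipE[OF assms(2)] by metis
  obtain K p where K: "0 \<le> K" "\<And>x. \<bar>\<phi> x\<bar> \<le> K * (1 + vnorm n x) ^ p"
    using C_lLip_growth[OF assms(1)] by metis
  obtain L q where L: "0 \<le> L" "\<And>x. \<bar>\<psi> x\<bar> \<le> L * (1 + vnorm n x) ^ q"
    using C_lLip_growth[OF assms(2)] by metis
  define r where "r = p + l + (q + k)"
  show ?thesis
  proof (rule C_lLipI[of "K * D + L * C" _ _ r])
    fix x y :: "nat \<Rightarrow> 'a"
    let ?v = "vnorm n (\<lambda>i. x i - y i)" and ?w = "1 + vnorm n x + vnorm n y"
    have "\<bar>\<phi> x * \<psi> x - \<phi> y * \<psi> y\<bar> = \<bar>\<phi> x * (\<psi> x - \<psi> y) + \<psi> y * (\<phi> x - \<phi> y)\<bar>"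
      by (simp add: algebra_simps)
    also have "\<dots> \<le> \<bar>\<phi> x\<bar> * \<bar>\<psi> x - \<psi> y\<bar> + \<bar>\<psi> y\<bar> * \<bar>\<phi> x - \<phi> y\<bar>"
      by (metis abs_mult abs_triangle_ineq)
    also have "\<dots> \<le> (K * (1 + vnorm n x) ^ p) * (D * ?w ^ l * ?v) + (L * (1 + vnorm n y) ^ q) * (C * ?w ^ k * ?v)"
      using K L C D by (intro add_mono mult_mono) auto
    also have "\<dots> \<le> (K * ?w ^ p) * (D * ?w ^ l * ?v) + (L * ?w ^ q) * (C * ?w ^ k * ?v)"
    proof -
      have "(1 + vnorm n x) ^ p \<le> ?w ^ p" "(1 + vnorm n y) ^ q \<le> ?w ^ q"
        by (intro power_mono; simp)+
      then show ?thesis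
        using K(1) L(1) C(1) D(1) by (intro add_mono mult_right_mono mult_left_mono) auto
    qed
    also have "\<dots> = K * D * ?w ^ (p + l) * ?v + L * C * ?w ^ (q + k) * ?v"
      by (simp add: power_add algebra_simps)
    also have "\<dots> \<le> K * D * ?w ^ r * ?v + L * C * ?w ^ r * ?v"
    proof -
      have "?w ^ (p + l) \<le> ?w ^ r" "?w ^ (q + k) \<le> ?w ^ r"
        by (intro power_increasing; simp add: r_def)+
      then show ?thesis
        using K(1) L(1) C(1) D(1) by (intro add_mono mult_right_mono mult_left_mono) auto
    qed
    finally show "\<bar>\<phi> x * \<psi> x - \<phi> y * \<psi> y\<bar> \<le> (K * D + L * C) * ?w ^ r * ?v"
      by (simp add: algebra_simps)
  qed (use K L C D in auto)
qed

lemma C_lLip_power: "\<phi> \<in> C_lLip n \<Longrightarrow> (\<lambda>x. \<phi> x ^ k) \<in> C_lLip n"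
  by (induction k) (auto intro: C_lLip_mult)

text \<open>The changes of variables below (concatenation, increments, partial sums, scaling,
  clipping) are globally Lipschitz in the components. Such a map grows at most linearly, so a
  polynomial factor stays polynomial.\<close>

lemma C_lLip_compose:
  assumes "\<phi> \<in> C_lLip n" "0 \<le> K"
    and L: "\<And>x y i. i < n \<Longrightarrow> norm (L x i - L y i) \<le> K * vnorm m (\<lambda>j. x j - y j)"
  shows "(\<lambda>x. \<phi> (L x)) \<in> C_lLip m"
proof -
  obtain C k where C: "0 \<le> C" "\<And>x y. \<bar>\<phi> x - \<phi> y\<bar> \<le> C * (1 + vnorm n x + vnorm n y) ^ k * vnorm n (\<lambda>i. x i - y i)"
    using C_lLipE[OF assms(1)] by metis
  have L': "vnorm n (\<lambda>i. L x i - L y i) \<le> n * K * vnorm m (\<lambda>j. x j - y j)" for x y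
    using vnorm_le_bound[of n "\<lambda>i. L x i - L y i"] L[of _ x y] by (simp add: mult.assoc)
  \<comment> \<open>Linear growth of L: its value at 0 enters once for x and once for y, and n * K
    is its Lipschitz constant for the vector norms.\<close>
  define B where "B = 1 + 2 * vnorm n (L (\<lambda>_. 0)) + n * K"
  have B: "1 \<le> B" using assms(2) by (simp add: B_def)
  have w: "1 + vnorm n (L x) + vnorm n (L y) \<le> B * (1 + vnorm m x + vnorm m y)" for x y
  proof -
    have "vnorm n (L z) \<le> vnorm n (L (\<lambda>_. 0)) + n * K * vnorm m z" for z
      using vnorm_diff[of n "L z" "L (\<lambda>_. 0)"] L'[of z "\<lambda>_. 0"] by simp
    from this[of x] this[of y]
    have "1 + vnorm n (L x) + vnorm n (L y) \<le> 1 + 2 * vnorm n (L (\<lambda>_. 0)) + n * K * (vnorm m x + vnorm m y)"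
      by (simp add: algebra_simps)
    also have "\<dots> \<le> (1 + 2 * vnorm n (L (\<lambda>_. 0))) * (1 + vnorm m x + vnorm m y) + n * K * (1 + vnorm m x + vnorm m y)"
    proof (rule add_mono)
      show "1 + 2 * vnorm n (L (\<lambda>_. 0)) \<le> (1 + 2 * vnorm n (L (\<lambda>_. 0))) * (1 + vnorm m x + vnorm m y)"
        by (simp add: algebra_simps)
      show "n * K * (vnorm m x + vnorm m y) \<le> n * K * (1 + vnorm m x + vnorm m y)"
        using assms(2) by (intro mult_left_mono) auto
    qed
    finally show ?thesis by (simp add: B_def algebra_simps)
  qed
  show ?thesis
  proof (rule C_lLipI[of "C * B ^ k * (n * K)" _ _ k])
    fix x y
    have "\<bar>\<phi> (L x) - \<phi> (L y)\<bar> \<le> C * (1 + vnorm n (L x) + vnorm n (L y)) ^ k * vnorm n (\<lambda>i. L x i - L y i)"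
      by (rule C)
    also have "\<dots> \<le> C * (B * (1 + vnorm m x + vnorm m y)) ^ k * (n * K * vnorm m (\<lambda>j. x j - y j))"
      using C(1) B by (intro mult_mono mult_left_mono power_mono w L') auto
    finally show "\<bar>\<phi> (L x) - \<phi> (L y)\<bar> \<le> C * B ^ k * (n * K) * (1 + vnorm m x + vnorm m y) ^ k * vnorm m (\<lambda>j. x j - y j)"
      by (simp add: power_mult_distrib mult_ac)
  qed (use C B assms(2) in auto)
qed

lemma C_lLip_vjoin:
  assumes "\<phi> \<in> C_lLip (m + n)"
  shows "(\<lambda>y. \<phi> (vjoin m x y)) \<in> C_lLip n"
proof (rule C_lLip_compose[OF assms, of 1])
  fix y z :: "nat \<Rightarrow> 'a" and i assume "i < m + n"
  then show "norm (vjoin m x y i - vjoin m x z i) \<le> 1 * vnorm n (\<lambda>j. y j - z j)"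
    using norm_le_vnorm[of "i - m" n "\<lambda>j. y j - z j"] by (auto simp: vjoin_def)
qed auto

section \<open>Elementary rules for sublinear expectations\<close>

locale sublinear =
  fixes \<Omega> :: "'w set" and H :: "('w \<Rightarrow> real) set" and E :: "('w \<Rightarrow> real) \<Rightarrow> real"
  assumes sublinear_expectation: "sublinear_expectation \<Omega> H E"
begin

lemma H_const [simp]: "(\<lambda>_. c) \<in> H"
  and H_add: "X \<in> H \<Longrightarrow> Y \<in> H \<Longrightarrow> (\<lambda>\<omega>. X \<omega> + Y \<omega>) \<in> H"
  and H_cmult: "X \<in> H \<Longrightarrow> (\<lambda>\<omega>. c * X \<omega>) \<in> H"
  and E_mono: "X \<in> H \<Longrightarrow> Y \<in> H \<Longrightarrow> (\<And>\<omega>. \<omega> \<in> \<Omega> \<Longrightarrow> X \<omega> \<le> Y \<omega>) \<Longrightarrow> E X \<le> E Y"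
  and E_const [simp]: "E (\<lambda>_. c) = c"
  and E_diff: "X \<in> H \<Longrightarrow> Y \<in> H \<Longrightarrow> E X - E Y \<le> E (\<lambda>\<omega>. X \<omega> - Y \<omega>)"
  and E_cmult: "0 \<le> c \<Longrightarrow> X \<in> H \<Longrightarrow> E (\<lambda>\<omega>. c * X \<omega>) = c * E X"
  using sublinear_expectation unfolding sublinear_expectation_def by auto

lemma H_diff: "X \<in> H \<Longrightarrow> Y \<in> H \<Longrightarrow> (\<lambda>\<omega>. X \<omega> - Y \<omega>) \<in> H"
  using H_add[OF _ H_cmult, of X Y "-1"] by simp

lemma E_cong:
  assumes "X \<in> H" "Y \<in> H" "\<And>\<omega>. \<omega> \<in> \<Omega> \<Longrightarrow> X \<omega> = Y \<omega>"
  shows "E X = E Y"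
  using assms by (intro antisym E_mono) auto

lemma E_add: "X \<in> H \<Longrightarrow> Y \<in> H \<Longrightarrow> E (\<lambda>\<omega>. X \<omega> + Y \<omega>) \<le> E X + E Y"
  using E_diff[OF H_add, of X Y Y] by simp

lemma E_add_const: "X \<in> H \<Longrightarrow> E (\<lambda>\<omega>. X \<omega> + c) = E X + c"
  using E_diff[of "\<lambda>\<omega>. X \<omega> + c" X] E_diff[of X "\<lambda>\<omega>. X \<omega> + c"] H_add[of X "\<lambda>_. c"] by simp

lemma H_sum: "(\<And>i. i \<in> I \<Longrightarrow> X i \<in> H) \<Longrightarrow> (\<lambda>\<omega>. \<Sum>i\<in>I. X i \<omega>) \<in> H"
  by (induction I rule: infinite_finite_induct) (auto intro: H_add)

lemma E_sum: "(\<And>i. i \<in> I \<Longrightarrow> X i \<in> H) \<Longrightarrow> E (\<lambda>\<omega>. \<Sum>i\<in>I. X i \<omega>) \<le> (\<Sum>i\<in>I. E (X i))"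
proof (induction I rule: infinite_finite_induct)
  case (insert i I)
  then show ?case using E_add[of "X i" "\<lambda>\<omega>. \<Sum>i\<in>I. X i \<omega>"] H_sum[of I X] by simp
qed auto

lemma E_abs_diff:
  assumes "X \<in> H" "Y \<in> H" "Z \<in> H" "\<And>\<omega>. \<omega> \<in> \<Omega> \<Longrightarrow> \<bar>X \<omega> - Y \<omega>\<bar> \<le> Z \<omega>"
  shows "\<bar>E X - E Y\<bar> \<le> E Z"
proof -
  have "E (\<lambda>\<omega>. X \<omega> - Y \<omega>) \<le> E Z" "E (\<lambda>\<omega>. Y \<omega> - X \<omega>) \<le> E Z"
    using assms by (auto intro!: E_mono H_diff dest!: assms(4))
  then show ?thesis using E_diff[of X Y] E_diff[of Y X] assms by linarith
qed

lemma E_nonneg: "X \<in> H \<Longrightarrow> (\<And>\<omega>. \<omega> \<in> \<Omega> \<Longrightarrow> 0 \<le> X \<omega>) \<Longrightarrow> 0 \<le> E X"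
  using E_mono[of "\<lambda>_. 0" X] by simp

text \<open>Integrating out the variables y must lead back to \<open>C_lLip\<close>, as nested
  expectations are formed from the result. The growth factor separates by 1 + |(x,y)| + |(x',y)|
  \<le> (1 + |x| + |x'|) (1 + 2|y|), and its first part leaves E by positive homogeneity.\<close>

lemma C_lLip_parameter:
  fixes Y :: "nat \<Rightarrow> 'w \<Rightarrow> 'v::real_normed_vector"
  assumes Y: "random_vector H n Y" and \<phi>: "\<phi> \<in> C_lLip (m + n)"
  shows "(\<lambda>x. E (\<lambda>w. \<phi> (vjoin m x (\<lambda>i. Y i w)))) \<in> C_lLip m"
proof -
  obtain C k where C: "0 \<le> C" "\<And>x y. \<bar>\<phi> x - \<phi> y\<bar> \<le> C * (1 + vnorm (m + n) x + vnorm (m + n) y) ^ k * vnorm (m + n) (\<lambda>i. x i - y i)"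
    using C_lLipE[OF \<phi>] by metis
  let ?Z = "\<lambda>w. (1 + 2 * vnorm n (\<lambda>i. Y i w)) ^ k"
  have "(\<lambda>x. (1 + 2 * vnorm n x) ^ k) \<in> C_lLip n"
    by (intro C_lLip_power C_lLip_add C_lLip_mult C_lLip_vnorm C_lLip_const)
  then have Z: "?Z \<in> H"
    using Y unfolding random_vector_def by auto
  have H: "(\<lambda>w. \<phi> (vjoin m x (\<lambda>i. Y i w))) \<in> H" for x
    using C_lLip_vjoin[OF \<phi>, of x] Y unfolding random_vector_def by auto
  show ?thesis
  proof (rule C_lLipI[of "C * E ?Z" _ _ k])
    fix x x' :: "nat \<Rightarrow> 'v"
    let ?v = "vnorm m (\<lambda>i. x i - x' i)" and ?w = "1 + vnorm m x + vnorm m x'"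
    have "\<bar>E (\<lambda>w. \<phi> (vjoin m x (\<lambda>i. Y i w))) - E (\<lambda>w. \<phi> (vjoin m x' (\<lambda>i. Y i w)))\<bar>
      \<le> E (\<lambda>w. (C * ?w ^ k * ?v) * ?Z w)"
    proof (rule E_abs_diff[OF H H H_cmult[OF Z]])
      fix w
      let ?y = "\<lambda>i. Y i w"
      have "vnorm (m + n) (\<lambda>i. vjoin m x ?y i - vjoin m x' ?y i)
          = vnorm (m + n) (vjoin m (\<lambda>i. x i - x' i) (\<lambda>_. 0))"
        by (rule vnorm_cong) (auto simp: vjoin_def)
      also have "\<dots> \<le> ?v" using vnorm_vjoin[of m n "\<lambda>i. x i - x' i" "\<lambda>_. 0"] by simp
      finally have 1: "vnorm (m + n) (\<lambda>i. vjoin m x ?y i - vjoin m x' ?y i) \<le> ?v" .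
      have "1 + vnorm (m + n) (vjoin m x ?y) + vnorm (m + n) (vjoin m x' ?y) \<le> ?w + 2 * vnorm n ?y"
        using vnorm_vjoin[of m n x ?y] vnorm_vjoin[of m n x' ?y] by linarith
      also have "\<dots> \<le> ?w + 2 * vnorm n ?y + (vnorm m x + vnorm m x') * (2 * vnorm n ?y)" by simp
      also have "\<dots> = ?w * (1 + 2 * vnorm n ?y)" by (simp add: algebra_simps)
      finally have 2: "1 + vnorm (m + n) (vjoin m x ?y) + vnorm (m + n) (vjoin m x' ?y) \<le> ?w * (1 + 2 * vnorm n ?y)" .
      have "\<bar>\<phi> (vjoin m x ?y) - \<phi> (vjoin m x' ?y)\<bar> \<le> C * (?w * (1 + 2 * vnorm n ?y)) ^ k * ?v"
        by (rule order.trans[OF C(2)]) (use C(1) in \<open>intro mult_mono mult_left_mono power_mono 1 2; simp\<close>)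
      then show "\<bar>\<phi> (vjoin m x ?y) - \<phi> (vjoin m x' ?y)\<bar> \<le> (C * ?w ^ k * ?v) * ?Z w"
        by (simp add: power_mult_distrib mult_ac)
    qed
    also have "\<dots> = (C * ?w ^ k * ?v) * E ?Z"
      using C(1) by (intro E_cmult Z) auto
    finally show "\<bar>E (\<lambda>w. \<phi> (vjoin m x (\<lambda>i. Y i w))) - E (\<lambda>w. \<phi> (vjoin m x' (\<lambda>i. Y i w)))\<bar> \<le> C * E ?Z * ?w ^ k * ?v"
      by (simp add: mult_ac)
  qed (use C(1) E_nonneg[OF Z] in auto)
qed

end

section \<open>Cylinder functions and concatenation of paths\<close>

text \<open>With \<open>min t s\<close> one formula covers both sides of s, since the increment of
  \<open>\<omega>'\<close> vanishes for t \<le> s. Continuity and boundedness then need no gluing at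
  s.\<close>

definition pconcat :: "real \<Rightarrow> 'd::finite path \<Rightarrow> 'd path \<Rightarrow> 'd path"
  where "pconcat s \<omega> \<omega>' = Bcontfun (\<lambda>t. BM (min t s) \<omega> + (BM t \<omega>' - BM (min t s) \<omega>'))"

lemma BM_pconcat: "BM t (pconcat s \<omega> \<omega>') = BM (min t s) \<omega> + (BM t \<omega>' - BM (min t s) \<omega>')"
proof -
  have c: "continuous_on UNIV (\<lambda>t. BM (min t s) \<eta>)" for \<eta> :: "'a path"
    by (intro continuous_on_compose2[OF continuous_on_apply_bcontfun[of UNIV \<eta>]] continuous_intros) auto
  have b: "bounded (range (\<lambda>t. BM (min t s) \<eta>))" for \<eta> :: "'a path"
    by (rule bounded_subset[OF bounded_apply_bcontfun[of \<eta>]]) auto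
  have "(\<lambda>t. BM (min t s) \<omega> + (BM t \<omega>' - BM (min t s) \<omega>')) \<in> bcontfun"
    unfolding bcontfun_def
    by (auto intro!: continuous_intros c b bounded_plus_comp bounded_minus_comp)
  then show ?thesis by (simp add: pconcat_def Bcontfun_inverse)
qed

lemma BM_0 [simp]: "\<omega> \<in> path_space T \<Longrightarrow> BM 0 \<omega> = 0"
  by (simp add: path_space_def)

lemma pconcat_in_path_space [simp]:
  assumes "\<omega> \<in> path_space T" "\<omega>' \<in> path_space T" "0 \<le> s" "s \<le> T"
  shows "pconcat s \<omega> \<omega>' \<in> path_space T"
proof -
  have *: "BM t \<eta> = BM (max 0 (min T t)) \<eta>" if "\<eta> \<in> path_space T" for t and \<eta> :: "'a path"
    using that unfolding path_space_def by blast
  have "min (max 0 (min T t)) s = max 0 (min T (min t s))" for t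
    using assms(3,4) by (auto simp: min_def max_def)
  then have **: "BM (min t s) \<eta> = BM (min (max 0 (min T t)) s) \<eta>" if "\<eta> \<in> path_space T" for t and \<eta> :: "'a path"
    using *[OF that, of "min t s"] by simp
  have "BM t (pconcat s \<omega> \<omega>') = BM (max 0 (min T t)) (pconcat s \<omega> \<omega>')" for t
    unfolding BM_pconcat using **[OF assms(1), of t] **[OF assms(2), of t] *[OF assms(2), of t] by simp
  moreover have "BM 0 (pconcat s \<omega> \<omega>') = 0"
    using assms by (simp add: BM_pconcat)
  ultimately show ?thesis unfolding path_space_def by blast
qed

lemma pconcat_assoc:
  "s \<le> t \<Longrightarrow> pconcat t (pconcat s \<omega> \<omega>') \<omega>'' = pconcat s \<omega> (pconcat t \<omega>' \<omega>'')"
  by (rule bcontfun_eqI) (auto simp: BM_pconcat min_def)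

lemma pconcat_absorb: "s \<le> t \<Longrightarrow> pconcat s (pconcat t \<omega> \<omega>') \<omega>'' = pconcat s \<omega> \<omega>''"
  by (rule bcontfun_eqI) (auto simp: BM_pconcat min_def)

section \<open>Closure properties of the space of cylinder functions\<close>

lemma H0I:
  assumes "1 \<le> n" "\<And>i. i < n \<Longrightarrow> t i \<in> {0..T}" "\<phi> \<in> C_lLip n"
    "\<And>\<omega>. \<omega> \<in> path_space T \<Longrightarrow> X \<omega> = \<phi> (\<lambda>i. BM (t i) \<omega>)"
  shows "X \<in> H0 T"
  using assms unfolding H0_def by blast

lemma H0E:
  assumes "X \<in> H0 T"
  obtains n t \<phi> where "1 \<le> n" "\<And>i. i < n \<Longrightarrow> t i \<in> {0..T}" "\<phi> \<in> C_lLip n"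
    "\<And>\<omega>. \<omega> \<in> path_space T \<Longrightarrow> X \<omega> = \<phi> (\<lambda>i. BM (t i) \<omega>)"
  using assms unfolding H0_def by blast

lemma H0_cong:
  "X \<in> H0 T \<Longrightarrow> (\<And>\<omega>. \<omega> \<in> path_space T \<Longrightarrow> Y \<omega> = X \<omega>) \<Longrightarrow> Y \<in> H0 T"
  unfolding H0_def by simp

lemma H0_mult:
  assumes "X \<in> H0 T" "Y \<in> H0 T"
  shows "(\<lambda>\<omega>. X \<omega> * Y \<omega>) \<in> H0 T"
proof -
  obtain n t \<phi> where X: "1 \<le> n" "\<And>i. i < n \<Longrightarrow> t i \<in> {0..T}" "\<phi> \<in> C_lLip n"
    "\<And>\<omega>. \<omega> \<in> path_space T \<Longrightarrow> X \<omega> = \<phi> (\<lambda>i. BM (t i) \<omega>)"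
    using H0E[OF assms(1)] by metis
  obtain m u \<psi> where Y: "1 \<le> m" "\<And>i. i < m \<Longrightarrow> u i \<in> {0..T}" "\<psi> \<in> C_lLip m"
    "\<And>\<omega>. \<omega> \<in> path_space T \<Longrightarrow> Y \<omega> = \<psi> (\<lambda>i. BM (u i) \<omega>)"
    using H0E[OF assms(2)] by metis
  have "\<phi> \<in> C_lLip (n + m)"
  proof (rule C_lLip_compose[OF X(3), of 1 "\<lambda>x. x"])
    fix x y :: "nat \<Rightarrow> real^'a" and i assume "i < n"
    then show "norm (x i - y i) \<le> 1 * vnorm (n + m) (\<lambda>i. x i - y i)"
      using norm_le_vnorm[of i "n + m" "\<lambda>i. x i - y i"] by simp
  qed auto
  moreover have "(\<lambda>x. \<psi> (\<lambda>i. x (n + i))) \<in> C_lLip (n + m)"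
  proof (rule C_lLip_compose[OF Y(3), of 1 "\<lambda>x i. x (n + i)"])
    fix x y :: "nat \<Rightarrow> real^'a" and i assume "i < m"
    then show "norm (x (n + i) - y (n + i)) \<le> 1 * vnorm (n + m) (\<lambda>i. x i - y i)"
      using norm_le_vnorm[of "n + i" "n + m" "\<lambda>i. x i - y i"] by simp
  qed auto
  ultimately have *: "(\<lambda>x. \<phi> x * \<psi> (\<lambda>i. x (n + i))) \<in> C_lLip (n + m)"
    by (rule C_lLip_mult)
  show ?thesis
  proof (rule H0I[of "n + m" "vjoin n t u", OF _ _ *])
    show "\<And>i. i < n + m \<Longrightarrow> vjoin n t u i \<in> {0..T}"
      using X(2) Y(2) by (auto simp: vjoin_def)
    fix \<omega> :: "'a path" assume "\<omega> \<in> path_space T"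
    moreover have "\<phi> (\<lambda>i. BM (vjoin n t u i) \<omega>) = \<phi> (\<lambda>i. BM (t i) \<omega>)"
      by (rule C_lLip_cong_arg[OF X(3)]) (simp add: vjoin_def)
    moreover have "\<psi> (\<lambda>i. BM (vjoin n t u (n + i)) \<omega>) = \<psi> (\<lambda>i. BM (u i) \<omega>)"
      by (rule C_lLip_cong_arg[OF Y(3)]) (simp add: vjoin_def)
    ultimately show "X \<omega> * Y \<omega> = \<phi> (\<lambda>i. BM (vjoin n t u i) \<omega>) * \<psi> (\<lambda>i. BM (vjoin n t u (n + i)) \<omega>)"
      using X Y by simp
  qed (use X in simp)
qed

lemma H0_lipschitz:
  assumes "X \<in> H0 T" "0 \<le> K" "\<And>a b. \<bar>f a - f b\<bar> \<le> K * \<bar>a - b\<bar>"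
  shows "(\<lambda>\<omega>. f (X \<omega>)) \<in> H0 T"
proof -
  obtain n t \<phi> where X: "1 \<le> n" "\<And>i. i < n \<Longrightarrow> t i \<in> {0..T}" "\<phi> \<in> C_lLip n"
    "\<And>\<omega>. \<omega> \<in> path_space T \<Longrightarrow> X \<omega> = \<phi> (\<lambda>i. BM (t i) \<omega>)"
    using H0E[OF assms(1)] by metis
  show ?thesis
    by (rule H0I[OF X(1,2) C_lLip_lipschitz[OF X(3) assms(2,3)]]) (use X in auto)
qed

lemma H0_abs: "X \<in> H0 T \<Longrightarrow> (\<lambda>\<omega>. \<bar>X \<omega>\<bar>) \<in> H0 T"
  by (rule H0_lipschitz[of X T 1 abs]) auto

lemma H0_norm_diff:
  assumes "u \<in> {0..T}" "v \<in> {0..T}"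
  shows "(\<lambda>\<omega>. norm (BM u \<omega> - BM v \<omega>)) \<in> H0 T"
proof (rule H0I[of 2 "\<lambda>i. if i = 0 then u else v"])
  \<comment> \<open>The redundant test puts the function in the form \<open>\<phi> (L x)\<close>
    with \<open>\<phi>\<close> the norm of component 0, as \<open>C_lLip_compose\<close>
    requires.\<close>
  have "(\<lambda>x. norm ((if 0 = (0::nat) then x 0 - x 1 else 0) :: real^'a)) \<in> C_lLip 2"
  proof (rule C_lLip_compose[OF C_lLip_norm[of 0 1], of 2 "\<lambda>x i. if i = 0 then x 0 - x 1 else 0"])
    fix x y :: "nat \<Rightarrow> real^'a" and i :: nat
    have "norm (x 0 - x 1 - (y 0 - y 1)) \<le> norm (x 0 - y 0) + norm (x 1 - y 1)"
      using norm_triangle_ineq4[of "x 0 - y 0" "x 1 - y 1"] by (simp add: algebra_simps)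
    then show "norm ((if i = 0 then x 0 - x 1 else 0) - (if i = 0 then y 0 - y 1 else 0)) \<le> 2 * vnorm 2 (\<lambda>j. x j - y j)"
      using norm_le_vnorm[of 0 2 "\<lambda>j. x j - y j"] norm_le_vnorm[of 1 2 "\<lambda>j. x j - y j"] by auto
  qed auto
  then show "(\<lambda>x. norm (x 0 - x 1 :: real^'a)) \<in> C_lLip 2" by simp
qed (use assms in auto)

text \<open>The values of the fixed path \<open>\<omega>\<close> are constants; the variable path is
  read at the times \<open>t i\<close> and \<open>min (t i) s\<close>, which doubles the number of
  time points.\<close>

lemma H0_pconcat:
  fixes X :: "'d::finite path \<Rightarrow> real"
  assumes "X \<in> H0 T" "\<omega> \<in> path_space T" "s \<in> {0..T}"
  shows "(\<lambda>\<omega>'. X (pconcat s \<omega> \<omega>')) \<in> H0 T"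
proof -
  obtain n t \<phi> where X: "1 \<le> n" "\<And>i. i < n \<Longrightarrow> t i \<in> {0..T}" "\<phi> \<in> C_lLip n"
    "\<And>\<omega>. \<omega> \<in> path_space T \<Longrightarrow> X \<omega> = \<phi> (\<lambda>i. BM (t i) \<omega>)"
    using H0E[OF assms(1)] by metis
  let ?L = "\<lambda>x i. BM (min (t i) s) \<omega> + (x i - x (n + i))"
  have *: "(\<lambda>x. \<phi> (?L x)) \<in> C_lLip (n + n)"
  proof (rule C_lLip_compose[OF X(3), of 2 ?L])
    fix x y :: "nat \<Rightarrow> real^'d" and i assume "i < n"
    moreover have "norm (?L x i - ?L y i) \<le> norm (x i - y i) + norm (x (n + i) - y (n + i))"
      using norm_triangle_ineq4[of "x i - y i" "x (n + i) - y (n + i)"] by (simp add: algebra_simps)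
    ultimately show "norm (?L x i - ?L y i) \<le> 2 * vnorm (n + n) (\<lambda>j. x j - y j)"
      using norm_le_vnorm[of i "n + n" "\<lambda>j. x j - y j"] norm_le_vnorm[of "n + i" "n + n" "\<lambda>j. x j - y j"]
      by simp
  qed auto
  show ?thesis
  proof (rule H0I[of "n + n" "vjoin n t (\<lambda>i. min (t i) s)", OF _ _ *])
    show "vjoin n t (\<lambda>i. min (t i) s) i \<in> {0..T}" if "i < n + n" for i
      using X(2)[of i] X(2)[of "i - n"] that assms(3) by (auto simp: vjoin_def)
    fix \<omega>' :: "'d path" assume "\<omega>' \<in> path_space T"
    then have "pconcat s \<omega> \<omega>' \<in> path_space T" using assms by auto
    then have "X (pconcat s \<omega> \<omega>') = \<phi> (\<lambda>i. BM (t i) (pconcat s \<omega> \<omega>'))" by (rule X(4))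
    also have "\<dots> = \<phi> (?L (\<lambda>i. BM (vjoin n t (\<lambda>i. min (t i) s) i) \<omega>'))"
      by (rule C_lLip_cong_arg[OF X(3)]) (simp add: vjoin_def BM_pconcat)
    finally show "X (pconcat s \<omega> \<omega>') = \<phi> (?L (\<lambda>i. BM (vjoin n t (\<lambda>i. min (t i) s) i) \<omega>'))" .
  qed (use X in simp)
qed

section \<open>Partitions and the representation by increments\<close>

lemma time_partition_mono:
  assumes "time_partition T m t" "i \<le> j" "j \<le> m"
  shows "t i \<le> t j"
  using assms(2,3)
proof (induction rule: dec_induct)
  case (step j)
  then show ?case using assms(1) unfolding time_partition_def by (smt (verit) Suc_leD Suc_le_lessD)
qed simp

lemma time_partition_range:
  assumes "time_partition T m t" "i \<le> m"
  shows "t i \<in> {0..T}"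
  using time_partition_mono[OF assms(1), of 0 i] time_partition_mono[OF assms(1), of i m] assms
  unfolding time_partition_def by auto

lemma H0_increments:
  assumes "time_partition T m t" "\<phi> \<in> C_lLip m" "\<And>\<omega>. \<omega> \<in> path_space T \<Longrightarrow> X \<omega> = \<phi> (increments t \<omega>)"
  shows "X \<in> H0 T"
proof (rule H0I[of "Suc m" t])
  show "(\<lambda>x. \<phi> (\<lambda>i. x (Suc i) - x i)) \<in> C_lLip (Suc m)"
  proof (rule C_lLip_compose[OF assms(2), of 2 "\<lambda>x i. x (Suc i) - x i"])
    fix x y :: "nat \<Rightarrow> real^'a" and i assume "i < m"
    moreover have "norm (x (Suc i) - x i - (y (Suc i) - y i)) \<le> norm (x (Suc i) - y (Suc i)) + norm (x i - y i)"
      using norm_triangle_ineq4[of "x (Suc i) - y (Suc i)" "x i - y i"] by (simp add: algebra_simps)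
    ultimately show "norm (x (Suc i) - x i - (y (Suc i) - y i)) \<le> 2 * vnorm (Suc m) (\<lambda>j. x j - y j)"
      using norm_le_vnorm[of i "Suc m" "\<lambda>j. x j - y j"] norm_le_vnorm[of "Suc i" "Suc m" "\<lambda>j. x j - y j"]
      by simp
  qed auto
qed (use assms time_partition_range[OF assms(1)] in \<open>auto simp: increments_def\<close>)

lemma time_partition_exists:
  fixes S :: "real set"
  assumes "0 < T" "finite S" "S \<subseteq> {0..T}" "0 \<in> S" "T \<in> S"
  obtains m t where "time_partition T m t" "S = t ` {..m}"
proof -
  define l where "l = sorted_list_of_set S"
  have l: "set l = S" "length l = card S" "sorted l" "distinct l"
    using assms(2) by (auto simp: l_def)
  \<comment> \<open>0 and T are distinct, so there is at least one interval.\<close>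
  have "card {0, T} \<le> card S" using assms by (intro card_mono) auto
  then have c: "2 \<le> length l" using assms(1) l by simp
  define m where "m = length l - 1"
  define t where "t j = l ! j" for j
  have strict: "t i < t (Suc i)" if "i < m" for i
  proof -
    have "Suc i < length l" using that by (simp add: m_def)
    then show ?thesis
      using l(3,4) sorted_nth_mono[of l i "Suc i"] nth_eq_iff_index_eq[of l i "Suc i"]
      by (auto simp: t_def less_le)
  qed
  have img: "S = t ` {..m}"
    using l(1) c unfolding t_def m_def set_conv_nth by force
  obtain k where "k < length l" "l ! k = 0" using assms(4) l(1) by (metis in_set_conv_nth)
  then have "t 0 \<le> 0" using sorted_nth_mono[OF l(3), of 0 k] by (simp add: t_def)
  moreover have "t 0 \<in> S" "t m \<in> S" using img by auto
  ultimately have "t 0 = 0" "t m \<le> T" using assms(3) by auto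
  then have "time_partition T m t"
    unfolding time_partition_def using c strict by (auto simp: m_def)
  then show ?thesis using that img by blast
qed

text \<open>Since B_0 = 0, the value of B at a partition point is the sum of the increments before
  it. The partition collects the times of X and s, together with 0 and T, which guarantee the
  starting point and at least one interval.\<close>

lemma H0_repr:
  assumes "X \<in> H0 T" "s \<in> {0..T}" "0 < T"
  obtains m t i \<phi> where "time_partition T m t" "i \<le> m" "t i = s" "\<phi> \<in> C_lLip m"
    "\<And>\<omega>. \<omega> \<in> path_space T \<Longrightarrow> X \<omega> = \<phi> (increments t \<omega>)"
proof -
  obtain n u \<phi> where X: "1 \<le> n" "\<And>i. i < n \<Longrightarrow> u i \<in> {0..T}" "\<phi> \<in> C_lLip n"
    "\<And>\<omega>. \<omega> \<in> path_space T \<Longrightarrow> X \<omega> = \<phi> (\<lambda>i. BM (u i) \<omega>)"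
    using H0E[OF assms(1)] by metis
  obtain m t where t: "time_partition T m t" "{0, s, T} \<union> u ` {..<n} = t ` {..m}"
    by (rule time_partition_exists[of T "{0, s, T} \<union> u ` {..<n}"]) (use assms X in auto)
  obtain i where i: "i \<le> m" "t i = s" using t(2) by (metis UnI1 atMost_iff imageE insertI1 insertI2)
  have "\<exists>J\<le>m. t J = u i" if "i < n" for i
  proof -
    have "u i \<in> t ` {..m}" using that t(2) by blast
    then show ?thesis by auto
  qed
  then obtain J where J: "\<And>i. i < n \<Longrightarrow> J i \<le> m" "\<And>i. i < n \<Longrightarrow> t (J i) = u i" by metis
  have "(\<lambda>x. \<phi> (\<lambda>i. \<Sum>j<J i. x j)) \<in> C_lLip m"
  proof (rule C_lLip_compose[OF X(3), of "real m" "\<lambda>x i. \<Sum>j<J i. x j"])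
    fix x y :: "nat \<Rightarrow> real^'a" and i assume i: "i < n"
    have "norm ((\<Sum>j<J i. x j) - (\<Sum>j<J i. y j)) \<le> (\<Sum>j<J i. norm (x j - y j))"
      by (simp add: sum_subtractf[symmetric] norm_sum)
    also have "\<dots> \<le> (\<Sum>j<m. norm (x j - y j))"
      using J(1)[OF i] by (intro sum_mono2) auto
    also have "\<dots> \<le> (\<Sum>j<m. vnorm m (\<lambda>j. x j - y j))"
      by (intro sum_mono) (use norm_le_vnorm[of _ m "\<lambda>j. x j - y j"] in simp)
    finally show "norm ((\<Sum>j<J i. x j) - (\<Sum>j<J i. y j)) \<le> real m * vnorm m (\<lambda>j. x j - y j)" by simp
  qed auto
  moreover have "X \<omega> = \<phi> (\<lambda>i. \<Sum>j<J i. increments t \<omega> j)" if \<omega>: "\<omega> \<in> path_space T" for \<omega>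
  proof -
    have "(\<Sum>j<J i. increments t \<omega> j) = BM (u i) \<omega>" if "i < n" for i
      using t(1) J(2)[OF that] \<omega>
      by (simp add: increments_def sum_lessThan_telescope[where f="\<lambda>j. BM (t j) \<omega>"] time_partition_def)
    then show ?thesis
      unfolding X(4)[OF \<omega>] by (intro C_lLip_cong_arg[OF X(3)]) simp
  qed
  ultimately show ?thesis using that t(1) i by blast
qed

text \<open>At a partition point, concatenation of paths becomes the substitution of increments by
  which \<open>cond_cylinder\<close> freezes the past.\<close>

lemma increments_pconcat:
  assumes "time_partition T m t" "i \<le> m" "j < m"
  shows "increments t (pconcat (t i) \<omega> \<omega>') j = (if j < i then increments t \<omega> j else increments t \<omega>' j)"
proof (cases "j < i")
  case True
  then have "min (t j) (t i) = t j" "min (t (Suc j)) (t i) = t (Suc j)"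
    using time_partition_mono[OF assms(1), of j i] time_partition_mono[OF assms(1), of "Suc j" i] assms by auto
  then show ?thesis using True by (simp add: increments_def BM_pconcat)
next
  case False
  then have "min (t j) (t i) = t i" "min (t (Suc j)) (t i) = t i"
    using time_partition_mono[OF assms(1), of i j] time_partition_mono[OF assms(1), of i "Suc j"] assms by auto
  then show ?thesis using False by (simp add: increments_def BM_pconcat)
qed

section \<open>The conditional expectation of cylinder functions\<close>

text \<open>The expectation of \<open>\<phi>\<close> at m independent variables of law e, with the
  last variable integrated first. Without additivity there is no Fubini theorem, so the order of
  nesting is part of the meaning. Unfilled components are 0.\<close>

primrec iterE :: "(('v::zero \<Rightarrow> real) \<Rightarrow> real) \<Rightarrow> nat \<Rightarrow> ((nat \<Rightarrow> 'v) \<Rightarrow> real) \<Rightarrow> real"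
  where "iterE e 0 \<phi> = \<phi> (\<lambda>_. 0)"
  | "iterE e (Suc m) \<phi> = iterE e m (\<lambda>x. e (\<lambda>v. \<phi> (x(m := v))))"

text \<open>The recursion starts at the zero sequence and only fills positions below m, so
  \<open>\<phi>\<close> is never evaluated elsewhere.\<close>

lemma iterE_cong:
  assumes "\<And>x. (\<And>j. m \<le> j \<Longrightarrow> x j = 0) \<Longrightarrow> \<phi> x = \<psi> x"
  shows "iterE e m \<phi> = iterE e m \<psi>"
  using assms
proof (induction m arbitrary: \<phi> \<psi>)
  case (Suc m)
  have eq: "(\<lambda>v. \<phi> (x(m := v))) = (\<lambda>v. \<psi> (x(m := v)))" if "\<And>j. m \<le> j \<Longrightarrow> x j = 0" for x
    using that by (intro ext Suc.prems) auto
  show ?case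
    unfolding iterE.simps
  proof (rule Suc.IH)
    fix x :: "nat \<Rightarrow> 'a" assume *: "\<And>j. m \<le> j \<Longrightarrow> x j = 0"
    show "e (\<lambda>v. \<phi> (x(m := v))) = e (\<lambda>v. \<psi> (x(m := v)))" by (simp only: eq[OF *])
  qed
qed auto

text \<open>The first i variables form the outer nest and the last k the inner one, in the original
  order. This is the algebraic core of E (E_s X) = E X.\<close>

lemma iterE_add:
  "iterE e (i + k) \<phi> = iterE e i (\<lambda>x. iterE e k (\<lambda>y. \<phi> (vjoin i x y)))"
proof (induction k arbitrary: \<phi>)
  case 0
  show ?case
  proof (simp, rule iterE_cong)
    fix x :: "nat \<Rightarrow> 'a" assume "\<And>j. i \<le> j \<Longrightarrow> x j = 0"
    then have "vjoin i x (\<lambda>_. 0) = x" by (auto simp: vjoin_def)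
    then show "\<phi> x = \<phi> (vjoin i x (\<lambda>_. 0))" by simp
  qed
next
  case (Suc k)
  have "(vjoin i x y)(i + k := v) = vjoin i x (y(k := v))" for x y and v :: 'a
    by (auto simp: vjoin_def fun_eq_iff)
  then show ?case using Suc.IH[of "\<lambda>x. e (\<lambda>v. \<phi> (x(i + k := v)))"] by simp
qed

lemma iterE_const: "(\<And>c. e (\<lambda>_. c) = c) \<Longrightarrow> iterE e m (\<lambda>_. c) = c"
  by (induction m) auto

definition cexp :: "(('d::finite path \<Rightarrow> real) \<Rightarrow> real) \<Rightarrow> real \<Rightarrow> ('d path \<Rightarrow> real) \<Rightarrow> 'd path \<Rightarrow> real"
  where "cexp E s X \<omega> = E (\<lambda>\<omega>'. X (pconcat s \<omega> \<omega>'))"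

section \<open>The law of the increments under the G-expectation\<close>

locale G_space =
  fixes \<Omega>' :: "'w set"
    and H' :: "('w \<Rightarrow> real) set"
    and E' :: "('w \<Rightarrow> real) \<Rightarrow> real"
    and G :: "real ^ 'd ^ 'd \<Rightarrow> real"
    and \<xi> :: "nat \<Rightarrow> 'w \<Rightarrow> real ^ 'd::finite"
    and T :: real
    and E :: "('d path \<Rightarrow> real) \<Rightarrow> real"
  assumes sublinear': "sublinear_expectation \<Omega>' H' E'"
    and iid: "iid_G_normal_sequence H' E' G \<xi>"
    and T_pos: "T > 0"
    and G_expectation: "G_expectation H' E' \<xi> T E"
begin

sublocale noise: sublinear \<Omega>' H' E'
  by unfold_locales (rule sublinear')

sublocale sublinear "path_space T" "H0 T" E
  by unfold_locales (use G_expectation in \<open>simp add: G_expectation_def\<close>)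

text \<open>By equality of laws, \<open>\<xi> 0\<close> stands for every
  \<open>\<xi> i\<close>.\<close>

definition e :: "(real ^ 'd \<Rightarrow> real) \<Rightarrow> real"
  where "e \<psi> = E' (\<lambda>w. \<psi> (\<xi> 0 w))"

lemma e_const: "e (\<lambda>_. c) = c"
  by (simp add: e_def)

lemma noise_random_vector: "random_vector H' 1 (\<lambda>_. \<xi> i)"
  using iid unfolding iid_G_normal_sequence_def G_normal_def by blast

lemma noise_identically_distributed:
  "\<phi> \<in> C_lLip 1 \<Longrightarrow> E' (\<lambda>w. \<phi> (\<lambda>_. \<xi> i w)) = E' (\<lambda>w. \<phi> (\<lambda>_. \<xi> j w))"
  using iid unfolding iid_G_normal_sequence_def identically_distributed_def by blast

lemma noise_independent:
  "\<phi> \<in> C_lLip (Suc i + 1) \<Longrightarrow>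
      E' (\<lambda>w. \<phi> (vjoin (Suc i) (\<lambda>j. \<xi> j w) (\<lambda>_. \<xi> (Suc i) w))) =
      E' (\<lambda>w. E' (\<lambda>w'. \<phi> (vjoin (Suc i) (\<lambda>j. \<xi> j w) (\<lambda>_. \<xi> (Suc i) w'))))"
  using iid unfolding iid_G_normal_sequence_def independent_to_def by blast

text \<open>Independence of the last variable from its predecessors integrates it out first,
  equality of laws replaces it by \<open>\<xi> 0\<close>, and \<open>C_lLip_parameter\<close> keeps
  what remains within reach of the induction hypothesis.\<close>

lemma noise_iterE:
  assumes "\<phi> \<in> C_lLip m"
  shows "E' (\<lambda>w. \<phi> (\<lambda>i. \<xi> i w)) = iterE e m \<phi>"
  using assms
proof (induction m arbitrary: \<phi>)
  case 0
  then have "(\<lambda>w. \<phi> (\<lambda>i. \<xi> i w)) = (\<lambda>w. \<phi> (\<lambda>_. 0))"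
    by (intro ext C_lLip_cong_arg[OF 0]) simp
  then show ?case by simp
next
  case (Suc m)
  have upd: "\<phi> (x(m := v)) = \<phi> (vjoin m x (\<lambda>_. v))" for x v
    by (rule C_lLip_cong_arg[OF Suc.prems]) (auto simp: vjoin_def)
  have \<phi>: "\<phi> \<in> C_lLip (m + 1)" using Suc.prems by simp
  let ?R = "\<lambda>x. e (\<lambda>v. \<phi> (x(m := v)))"
  have R: "?R \<in> C_lLip m"
    using noise.C_lLip_parameter[OF noise_random_vector \<phi>] by (simp add: e_def upd)
  have "E' (\<lambda>w. \<phi> (\<lambda>i. \<xi> i w)) = E' (\<lambda>w. ?R (\<lambda>i. \<xi> i w))"
  proof (cases m)
    \<comment> \<open>The independence assumption starts at \<open>\<xi> 1\<close>. A single
      variable has no predecessors, and \<open>?R\<close> is already the constant wanted.\<close>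
    case 0
    have "?R x = E' (\<lambda>w. \<phi> (\<lambda>i. \<xi> i w))" for x
      unfolding e_def by (intro arg_cong[of _ _ E'] ext C_lLip_cong_arg[OF Suc.prems]) (simp add: 0)
    then show ?thesis by simp
  next
    case (Suc k)
    have "\<phi> (\<lambda>i. \<xi> i w) = \<phi> (vjoin m (\<lambda>j. \<xi> j w) (\<lambda>_. \<xi> m w))" for w
      by (rule C_lLip_cong_arg[OF Suc.prems]) (auto simp: vjoin_def less_Suc_eq)
    moreover have "E' (\<lambda>w'. \<phi> (vjoin m x (\<lambda>_. \<xi> m w'))) = ?R x" for x
      using noise_identically_distributed[OF C_lLip_vjoin[OF \<phi>, of x], of m 0] by (simp add: e_def upd)
    ultimately show ?thesis using noise_independent[of \<phi> k] \<phi> Suc by simp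
  qed
  from this Suc.IH[OF R] show ?case unfolding iterE.simps by (rule trans)
qed

lemma E_increments:
  assumes "time_partition T m t" "\<phi> \<in> C_lLip m"
  shows "E (\<lambda>\<omega>. \<phi> (increments t \<omega>)) = iterE e m (\<lambda>y. \<phi> (\<lambda>i. sqrt (t (Suc i) - t i) *\<^sub>R y i))"
proof -
  have "(\<lambda>y. \<phi> (\<lambda>i. sqrt (t (Suc i) - t i) *\<^sub>R y i)) \<in> C_lLip m"
  proof (rule C_lLip_compose[OF assms(2), of "\<Sum>i<m. \<bar>sqrt (t (Suc i) - t i)\<bar>"])
    fix x y :: "nat \<Rightarrow> real^'d" and i assume i: "i < m"
    have "norm (sqrt (t (Suc i) - t i) *\<^sub>R x i - sqrt (t (Suc i) - t i) *\<^sub>R y i)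
        = \<bar>sqrt (t (Suc i) - t i)\<bar> * norm (x i - y i)"
      by (simp add: scaleR_diff_right[symmetric])
    also have "\<dots> \<le> (\<Sum>i<m. \<bar>sqrt (t (Suc i) - t i)\<bar>) * vnorm m (\<lambda>j. x j - y j)"
      using i norm_le_vnorm[of i m "\<lambda>j. x j - y j"]
        member_le_sum[of i "{..<m}" "\<lambda>i. \<bar>sqrt (t (Suc i) - t i)\<bar>"]
      by (intro mult_mono sum_nonneg) auto
    finally show "norm (sqrt (t (Suc i) - t i) *\<^sub>R x i - sqrt (t (Suc i) - t i) *\<^sub>R y i)
      \<le> (\<Sum>i<m. \<bar>sqrt (t (Suc i) - t i)\<bar>) * vnorm m (\<lambda>j. x j - y j)" .
  qed (auto intro: sum_nonneg)
  from noise_iterE[OF this] show ?thesis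
    using G_expectation assms unfolding G_expectation_def by simp
qed

text \<open>Concatenation thus agrees with freezing increments, for whatever partition through the
  time point represents X.\<close>

lemma cexp_increments:
  assumes X: "\<And>\<omega>. \<omega> \<in> path_space T \<Longrightarrow> X \<omega> = \<phi> (increments t \<omega>)"
    and t: "time_partition T m t" "i \<le> m" and \<phi>: "\<phi> \<in> C_lLip m" and \<omega>: "\<omega> \<in> path_space T"
  shows "cexp E (t i) X \<omega> = E (\<lambda>\<omega>'. \<phi> (\<lambda>j. if j < i then increments t \<omega> j else increments t \<omega>' j))"
proof -
  have ti: "t i \<in> {0..T}" using time_partition_range[OF t] .
  have XH: "X \<in> H0 T" by (rule H0_increments[OF t(1) \<phi> X])
  have eq: "X (pconcat (t i) \<omega> \<omega>') = \<phi> (\<lambda>j. if j < i then increments t \<omega> j else increments t \<omega>' j)"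
    if "\<omega>' \<in> path_space T" for \<omega>'
  proof -
    have "X (pconcat (t i) \<omega> \<omega>') = \<phi> (increments t (pconcat (t i) \<omega> \<omega>'))"
      using that \<omega> ti by (intro X) simp
    also have "\<dots> = \<phi> (\<lambda>j. if j < i then increments t \<omega> j else increments t \<omega>' j)"
      by (intro C_lLip_cong_arg[OF \<phi>] increments_pconcat[OF t])
    finally show ?thesis .
  qed
  have H: "(\<lambda>\<omega>'. X (pconcat (t i) \<omega> \<omega>')) \<in> H0 T"
    by (rule H0_pconcat[OF XH \<omega> ti])
  show ?thesis unfolding cexp_def
    by (rule E_cong[OF H H0_cong[OF H]]) (simp_all add: eq)
qed

text \<open>In terms of increments, E_s X is \<open>\<psi>\<close>: the first i are frozen, the rest
  integrated. By \<open>iterE_add\<close>, integrating \<open>\<psi>\<close> over the first i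
  variables rebuilds the full nest for X. The variables that one of the two nests ignores are
  dummies and disappear by \<open>iterE_const\<close>.\<close>

lemma
  assumes "X \<in> H0 T" "s \<in> {0..T}"
  shows cexp_H0: "cexp E s X \<in> H0 T"
    and E_cexp: "E (cexp E s X) = E X"
proof -
  obtain m t i \<phi> where t: "time_partition T m t" "i \<le> m" "t i = s" and \<phi>: "\<phi> \<in> C_lLip m"
    and X: "\<And>\<omega>. \<omega> \<in> path_space T \<Longrightarrow> X \<omega> = \<phi> (increments t \<omega>)"
    using H0_repr[OF assms T_pos] by metis
  define \<psi> where "\<psi> x = E (\<lambda>\<omega>'. \<phi> (\<lambda>j. if j < i then x j else increments t \<omega>' j))" for x
  have \<psi>_cong: "\<psi> x = \<psi> y" if "\<And>j. j < i \<Longrightarrow> x j = y j" for x y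
    unfolding \<psi>_def using that by (intro arg_cong[of _ _ E] ext arg_cong[of _ _ \<phi>]) auto
  have rv: "random_vector (H0 T) m (\<lambda>i \<omega>. increments t \<omega> i)"
    unfolding random_vector_def by (intro ballI H0_increments[OF t(1)]) auto
  let ?L = "\<lambda>z j. if j < i then z j else z (m + j)"
  have "(\<lambda>z. \<phi> (?L z)) \<in> C_lLip (m + m)"
  proof (rule C_lLip_compose[OF \<phi>, of 1])
    fix x y :: "nat \<Rightarrow> real^'d" and j assume "j < m"
    then show "norm (?L x j - ?L y j) \<le> 1 * vnorm (m + m) (\<lambda>j. x j - y j)"
      using norm_le_vnorm[of j "m + m" "\<lambda>j. x j - y j"] norm_le_vnorm[of "m + j" "m + m" "\<lambda>j. x j - y j"]
      by auto
  qed auto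
  from C_lLip_parameter[OF rv this]
  have "(\<lambda>x. E (\<lambda>w. \<phi> (?L (vjoin m x (increments t w))))) \<in> C_lLip m" .
  moreover have "?L (vjoin m x y) = (\<lambda>j. if j < i then x j else y j)" for x y :: "nat \<Rightarrow> real^'d"
    using t(2) by (auto simp: vjoin_def)
  ultimately have \<psi>: "\<psi> \<in> C_lLip m" by (simp add: \<psi>_def[abs_def])
  have c: "cexp E s X \<omega> = \<psi> (increments t \<omega>)" if "\<omega> \<in> path_space T" for \<omega>
    using cexp_increments[OF X t(1,2) \<phi> that] t(3) by (simp add: \<psi>_def)
  show cH: "cexp E s X \<in> H0 T"
    by (rule H0_increments[OF t(1) \<psi> c])
  \<comment> \<open>Brownian scaling, which turns the noise variables into increments over the
    partition intervals.\<close>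
  define \<sigma> where "\<sigma> y = (\<lambda>i. sqrt (t (Suc i) - t i) *\<^sub>R y i)" for y :: "nat \<Rightarrow> real^'d"
  have E_\<sigma>: "E (\<lambda>\<omega>. \<theta> (increments t \<omega>)) = iterE e m (\<lambda>y. \<theta> (\<sigma> y))" if "\<theta> \<in> C_lLip m" for \<theta>
    using E_increments[OF t(1) that] by (simp add: \<sigma>_def)
  obtain k where k: "m = i + k" using t(2) le_Suc_ex by blast
  have \<psi>_eval: "\<psi> (\<sigma> x) = iterE e k (\<lambda>y. \<phi> (\<sigma> (vjoin i x y)))" for x
  proof -
    let ?\<phi> = "\<lambda>z. \<phi> (\<lambda>j. if j < i then \<sigma> x j else z j)"
    have "?\<phi> \<in> C_lLip m"
    proof (rule C_lLip_compose[OF \<phi>, of 1])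
      fix y z :: "nat \<Rightarrow> real^'d" and j assume "j < m"
      then show "norm ((if j < i then \<sigma> x j else y j) - (if j < i then \<sigma> x j else z j)) \<le> 1 * vnorm m (\<lambda>j. y j - z j)"
        using norm_le_vnorm[of j m "\<lambda>j. y j - z j"] by auto
    qed auto
    then have "\<psi> (\<sigma> x) = iterE e m (\<lambda>y. ?\<phi> (\<sigma> y))"
      unfolding \<psi>_def by (rule E_\<sigma>)
    also have "\<dots> = iterE e i (\<lambda>x'. iterE e k (\<lambda>y. ?\<phi> (\<sigma> (vjoin i x' y))))"
      unfolding k by (rule iterE_add)
    \<comment> \<open>Positions below i are overridden by \<open>\<sigma> x\<close>, so the outer
      variables x' are dummies.\<close>
    also have "?\<phi> (\<sigma> (vjoin i x' y)) = \<phi> (\<sigma> (vjoin i x y))" for x' y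
      by (intro arg_cong[of _ _ \<phi>]) (auto simp: \<sigma>_def vjoin_def)
    then have "iterE e i (\<lambda>x'. iterE e k (\<lambda>y. ?\<phi> (\<sigma> (vjoin i x' y)))) = iterE e i (\<lambda>x'. iterE e k (\<lambda>y. \<phi> (\<sigma> (vjoin i x y))))"
      by (simp only:)
    finally show ?thesis by (simp add: iterE_const e_const)
  qed
  have "E (cexp E s X) = E (\<lambda>\<omega>. \<psi> (increments t \<omega>))"
    by (rule E_cong[OF cH H0_cong[OF cH]]) (simp_all add: c)
  also have "\<dots> = iterE e m (\<lambda>y. \<psi> (\<sigma> y))"
    by (rule E_\<sigma>[OF \<psi>])
  also have "\<dots> = iterE e i (\<lambda>x. iterE e k (\<lambda>y. \<psi> (\<sigma> (vjoin i x y))))"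
    unfolding k by (rule iterE_add)
  \<comment> \<open>Conversely, \<open>\<psi>\<close> looks only at positions below i, so here the
    inner variables y are dummies.\<close>
  also have "\<psi> (\<sigma> (vjoin i x y)) = \<psi> (\<sigma> x)" for x y
    by (intro \<psi>_cong) (auto simp: \<sigma>_def vjoin_def)
  then have "iterE e i (\<lambda>x. iterE e k (\<lambda>y. \<psi> (\<sigma> (vjoin i x y)))) = iterE e i (\<lambda>x. iterE e k (\<lambda>y. \<psi> (\<sigma> x)))"
    by (simp only:)
  also have "\<dots> = iterE e i (\<lambda>x. iterE e k (\<lambda>y. \<phi> (\<sigma> (vjoin i x y))))"
    by (simp add: iterE_const e_const \<psi>_eval)
  also have "\<dots> = iterE e m (\<lambda>y. \<phi> (\<sigma> y))"
    unfolding k by (rule iterE_add[symmetric])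
  also have "\<dots> = E (\<lambda>\<omega>. \<phi> (increments t \<omega>))"
    by (rule E_\<sigma>[OF \<phi>, symmetric])
  also have "\<dots> = E X"
    by (rule E_cong[OF H0_cong[OF assms(1)] assms(1)]) (simp_all add: X)
  finally show "E (cexp E s X) = E X" .
qed

lemma cexp_tower:
  assumes "X \<in> H0 T" "0 \<le> s" "s \<le> t" "t \<le> T" "\<omega> \<in> path_space T"
  shows "cexp E s (cexp E t X) \<omega> = cexp E s X \<omega>"
proof -
  have "cexp E s (cexp E t X) \<omega> = E (cexp E t (\<lambda>\<omega>'. X (pconcat s \<omega> \<omega>')))"
    using assms(3) by (simp add: cexp_def[abs_def] pconcat_assoc)
  also have "\<dots> = cexp E s X \<omega>"
    unfolding cexp_def[of E s] using assms by (intro E_cexp H0_pconcat) auto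
  finally show ?thesis .
qed

text \<open>Adaptedness: E_s does not see how the path continues after t. In the maximal inequality
  this turns past values into constants.\<close>

lemma cexp_pconcat:
  "s \<le> t \<Longrightarrow> cexp E s X (pconcat t \<omega> \<omega>') = cexp E s X \<omega>"
  by (simp add: cexp_def pconcat_absorb)

text \<open>Neither the partition nor \<open>\<phi>\<close> survives in the conclusion, so on the
  path space Y is independent of the representation chosen for X.\<close>

lemma cond_cylinder_cexp:
  assumes "cond_cylinder T E s X Y"
  shows "X \<in> H0 T" "s \<in> {0..T}" "\<And>\<omega>. \<omega> \<in> path_space T \<Longrightarrow> Y \<omega> = cexp E s X \<omega>"
proof -
  obtain m t i \<phi> where *: "\<phi> \<in> C_lLip m" "time_partition T m t" "i \<le> m" "t i = s"
    "\<And>\<omega>. \<omega> \<in> path_space T \<Longrightarrow> X \<omega> = \<phi> (increments t \<omega>)"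
    "\<And>\<omega>. \<omega> \<in> path_space T \<Longrightarrow> Y \<omega> = E (\<lambda>\<omega>'. \<phi> (\<lambda>j. if j < i then increments t \<omega> j else increments t \<omega>' j))"
    using assms unfolding cond_cylinder_def by blast
  show "X \<in> H0 T" by (rule H0_increments[OF *(2,1,5)])
  show "s \<in> {0..T}" using time_partition_range[OF *(2,3)] *(4) by simp
  show "Y \<omega> = cexp E s X \<omega>" if "\<omega> \<in> path_space T" for \<omega>
    using cexp_increments[OF *(5) *(2,3,1) that] *(4,6) that by simp
qed

lemma cexp_abs_diff:
  assumes "X \<in> H0 T" "Y \<in> H0 T" "s \<in> {0..T}" "\<omega> \<in> path_space T"
  shows "\<bar>cexp E s X \<omega> - cexp E s Y \<omega>\<bar> \<le> cexp E s (\<lambda>\<omega>. \<bar>X \<omega> - Y \<omega>\<bar>) \<omega>"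
  unfolding cexp_def using assms
  by (intro E_abs_diff H0_pconcat H0_pconcat[of "\<lambda>\<omega>. \<bar>X \<omega> - Y \<omega>\<bar>"] H0_abs H_diff) auto

text \<open>For u < v, the difference is the last increment of a partition with at most two
  intervals; an earlier variable is a dummy, and the square root leaves e by positive
  homogeneity.\<close>

lemma E_norm_BM_diff:
  assumes "0 \<le> u" "u \<le> v" "v \<le> T"
  shows "E (\<lambda>\<omega>. norm (BM v \<omega> - BM u \<omega>)) = sqrt (v - u) * e norm"
proof -
  have norm1: "iterE e (Suc m) (\<lambda>y. norm (sqrt r *\<^sub>R y m)) = sqrt r * e norm" if "0 \<le> r" for r m
  proof -
    have "(\<lambda>x. norm (x 0 :: real^'d)) \<in> C_lLip 1" by (rule C_lLip_norm) simp
    from bspec[OF noise_random_vector[unfolded random_vector_def] this, of 0]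
    have "(\<lambda>w. norm (\<xi> 0 w)) \<in> H'" .
    then have "e (\<lambda>v. sqrt r * norm v) = sqrt r * e norm"
      using that by (simp add: e_def noise.E_cmult)
    then show ?thesis using that by (simp add: iterE_const e_const)
  qed
  \<comment> \<open>Partition points increase strictly from 0, so u = v and u = 0 need their own
    cases.\<close>
  consider "u = v" | "u = 0" "0 < v" | "0 < u" "u < v" using assms by linarith
  then show ?thesis
  proof cases
    case 1 then show ?thesis by simp
  next
    case 2
    let ?t = "\<lambda>i. if i = (0::nat) then 0 else v"
    have t: "time_partition T 1 ?t" using 2 assms by (simp add: time_partition_def)
    show ?thesis
      using E_increments[OF t C_lLip_norm[of 0 1]] norm1[of v 0] 2 by (simp add: increments_def)
  next
    case 3
    let ?t = "\<lambda>i. if i = (0::nat) then 0 else if i = 1 then u else v"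
    have t: "time_partition T 2 ?t" using 3 assms by (auto simp: time_partition_def less_2_cases_iff)
    show ?thesis
      using E_increments[OF t C_lLip_norm[of 1 2]] norm1[of "v - u" 1] 3
      by (simp add: increments_def numeral_2_eq_2)
  qed
qed

end

section \<open>A maximal inequality\<close>

locale G_space_repr = G_space \<Omega>' H' E' G \<xi> T E
  for \<Omega>' :: "'w set"
    and H' :: "('w \<Rightarrow> real) set"
    and E' :: "('w \<Rightarrow> real) \<Rightarrow> real"
    and G :: "real ^ 'd ^ 'd \<Rightarrow> real"
    and \<xi> :: "nat \<Rightarrow> 'w \<Rightarrow> real ^ 'd::finite"
    and T :: real
    and E :: "('d path \<Rightarrow> real) \<Rightarrow> real" +
  fixes \<P> :: "'d path measure set"
  assumes represents: "represents T \<P> E"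
begin

section \<open>Representing measures as Borel measures on the path space\<close>

abbreviation paths :: "'d path measure"
  where "paths \<equiv> restrict_space borel (path_space T)"

lemma repr_prob_space: "P \<in> \<P> \<Longrightarrow> prob_space P"
  and repr_sets: "P \<in> \<P> \<Longrightarrow> sets P = sets paths"
proof -
  have "\<P> \<subseteq> topspace (weak_topology (path_space T))"
    using represents unfolding represents_def by (blast dest: compactin_subset_topspace)
  also have "\<dots> \<subseteq> borel_prob_measures (path_space T)"
    unfolding weak_topology_def topology_generated_by_topspace by auto
  finally show "P \<in> \<P> \<Longrightarrow> prob_space P" "P \<in> \<P> \<Longrightarrow> sets P = sets paths"
    unfolding borel_prob_measures_def by auto
qed

lemma space_paths [simp]: "space paths = path_space T"
  by (simp add: space_restrict_space)

lemma repr_space: "P \<in> \<P> \<Longrightarrow> space P = path_space T"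
  using sets_eq_imp_space_eq[OF repr_sets] by simp

lemma repr_borel: "P \<in> \<P> \<Longrightarrow> borel_measurable P = borel_measurable paths"
  by (rule measurable_cong_sets) (auto simp: repr_sets)

lemma repr_integrable: "P \<in> \<P> \<Longrightarrow> X \<in> H0 T \<Longrightarrow> integrable P X"
  and repr_integral_le: "P \<in> \<P> \<Longrightarrow> X \<in> H0 T \<Longrightarrow> (\<integral>\<omega>. X \<omega> \<partial>P) \<le> E X"
  and repr_attained: "X \<in> H0 T \<Longrightarrow> \<exists>P\<in>\<P>. (\<integral>\<omega>. X \<omega> \<partial>P) = E X"
  using represents unfolding represents_def by auto

text \<open>The attained maximum shows that some P exists, and all P share the Borel sets of the
  path space.\<close>

lemma H0_measurable: "X \<in> H0 T \<Longrightarrow> X \<in> borel_measurable paths"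
  using repr_attained[of X] repr_integrable[of _ X] repr_borel by (metis borel_measurable_integrable)

text \<open>
  Stopping at the first time at which \<open>N\<close> exceeds \<open>c\<close> is not available within \<open>H0 T\<close>, so the
  indicator of not having stopped is replaced by the product \<open>S k\<close> of Lipschitz cutoffs.
\<close>

lemma maximal_inequality_discrete:
  assumes X: "X \<in> H0 T" "\<And>\<omega>. \<omega> \<in> path_space T \<Longrightarrow> 0 \<le> X \<omega>" and "0 < c"
    and t: "\<And>j. j \<le> n \<Longrightarrow> t j \<in> {0..T}" "\<And>j. j < n \<Longrightarrow> t j \<le> t (Suc j)"
    and P: "P \<in> \<P>"
  shows "measure P {\<omega> \<in> path_space T. \<exists>j\<le>n. c < cexp E (t j) X \<omega>} \<le> 2 * E X / c"
proof -
  \<comment> \<open>f is 1 up to c/2, 0 from c on and linear between; the gap between the two levels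
    gives the Lipschitz constant 2/c.\<close>
  define f where "f x = max 0 (min 1 (2 - 2 / c * x))" for x :: real
  have f01: "0 \<le> f x" "f x \<le> 1" for x by (auto simp: f_def)
  have f_lip: "\<bar>f a - f b\<bar> \<le> 2 / c * \<bar>a - b\<bar>" for a b
  proof -
    have "\<bar>f a - f b\<bar> \<le> \<bar>2 / c * a - 2 / c * b\<bar>" unfolding f_def by (auto simp: max_def min_def abs_if)
    also have "\<dots> = 2 / c * \<bar>a - b\<bar>"
      using \<open>0 < c\<close> abs_mult[of "2 / c" "a - b"] by (simp only: right_diff_distrib[symmetric]) simp
    finally show ?thesis .
  qed
  have f_0: "f x = 0" if "c < x" for x
    using that \<open>0 < c\<close> by (simp add: f_def field_simps)
  \<comment> \<open>Weight is removed by f only above the level c/2.\<close>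
  have f_prod: "0 \<le> (1 - f x) * (x - c / 2)" for x
  proof (cases "x \<le> c / 2")
    case True
    then have "f x = 1" using \<open>0 < c\<close> by (simp add: f_def field_simps)
    then show ?thesis by simp
  qed (use f01[of x] in simp)
  define N where "N j = cexp E (t j) X" for j
  define S where "S k \<omega> = (\<Prod>j\<le>k. f (N j \<omega>))" for k \<omega>
  \<comment> \<open>A martingale transform of N: the increment after \<open>t j\<close> carries the
    weight \<open>S j\<close>, which is known at \<open>t j\<close>. It replaces N stopped near its
    first passage of c.\<close>
  define W where "W k \<omega> = N 0 \<omega> + (\<Sum>j<k. S j \<omega> * (N (Suc j) \<omega> - N j \<omega>))" for k \<omega>
  have N_H0: "N j \<in> H0 T" if "j \<le> n" for j
    unfolding N_def by (rule cexp_H0[OF X(1) t(1)[OF that]])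
  have S_H0: "S k \<in> H0 T" if "k \<le> n" for k
    using that
  proof (induction k)
    case 0
    then show ?case unfolding S_def using H0_lipschitz[OF N_H0[of 0] _ f_lip] \<open>0 < c\<close> by simp
  next
    case (Suc k)
    have "(\<lambda>\<omega>. S k \<omega> * f (N (Suc k) \<omega>)) \<in> H0 T"
      using Suc \<open>0 < c\<close> by (intro H0_mult H0_lipschitz[OF N_H0 _ f_lip]) auto
    then show ?case by (simp add: S_def[abs_def] mult.commute)
  qed
  have W_H0: "W k \<in> H0 T" if "k \<le> n" for k
    unfolding W_def[abs_def] using that
    by (intro H_add H_sum H0_mult H_diff S_H0 N_H0) auto
  have N_nonneg: "0 \<le> N j \<omega>" if "j \<le> n" "\<omega> \<in> path_space T" for j \<omega>
    unfolding N_def cexp_def using X that t(1)[OF that(1)] by (intro E_nonneg H0_pconcat) auto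
  have t_mono: "t j \<le> t k" if "j \<le> k" "k \<le> n" for j k
    using that
  proof (induction rule: dec_induct)
    case (step i)
    then show ?case using t(2)[of i] by simp
  qed simp
  \<comment> \<open>Conditioned at \<open>t k\<close>, everything in \<open>W (Suc k)\<close> except
    \<open>N (Suc k)\<close> is constant, and the coefficient \<open>S k\<close> is nonnegative. So
    E meets only an affine function with nonnegative slope, on which it is exact.\<close>
  have E_W: "E (W k) = E X" if "k \<le> n" for k
    using that
  proof (induction k)
    case 0
    then show ?case using E_cexp[OF X(1) t(1)[of 0]] by (simp add: W_def N_def)
  next
    case (Suc k)
    have tk: "t k \<in> {0..T}" "t (Suc k) \<in> {0..T}" using Suc t(1) by auto
    have "cexp E (t k) (W (Suc k)) \<omega> = W k \<omega>" if \<omega>: "\<omega> \<in> path_space T" for \<omega>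
    proof -
      have NkH: "(\<lambda>\<omega>'. N (Suc k) (pconcat (t k) \<omega> \<omega>')) \<in> H0 T"
        using Suc by (intro H0_pconcat[OF N_H0 \<omega> tk(1)])
      have Nj: "N j (pconcat (t k) \<omega> \<omega>') = N j \<omega>" if "j \<le> k" for j \<omega>'
        unfolding N_def using that Suc by (intro cexp_pconcat t_mono) auto
      have Sj: "S j (pconcat (t k) \<omega> \<omega>') = S j \<omega>" if "j \<le> k" for j \<omega>'
        unfolding S_def using that by (intro prod.cong) (auto simp: Nj)
      have Wk: "W k (pconcat (t k) \<omega> \<omega>') = W k \<omega>" for \<omega>'
        unfolding W_def by (intro arg_cong2[of _ _ _ _ "(+)"] sum.cong) (auto simp: Nj Sj)
      have "W (Suc k) (pconcat (t k) \<omega> \<omega>')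
        = S k \<omega> * N (Suc k) (pconcat (t k) \<omega> \<omega>') + (W k \<omega> - S k \<omega> * N k \<omega>)" for \<omega>'
      proof -
        have W_Suc: "W (Suc k) \<eta> = W k \<eta> + S k \<eta> * (N (Suc k) \<eta> - N k \<eta>)" for \<eta>
          by (simp add: W_def)
        then show ?thesis
          using W_Suc[of "pconcat (t k) \<omega> \<omega>'"] by (simp add: Wk Nj Sj algebra_simps)
      qed
      then have "cexp E (t k) (W (Suc k)) \<omega>
        = E (\<lambda>\<omega>'. S k \<omega> * N (Suc k) (pconcat (t k) \<omega> \<omega>') + (W k \<omega> - S k \<omega> * N k \<omega>))"
        by (simp add: cexp_def)
      also have "\<dots> = S k \<omega> * E (\<lambda>\<omega>'. N (Suc k) (pconcat (t k) \<omega> \<omega>')) + (W k \<omega> - S k \<omega> * N k \<omega>)"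
        using f01 by (simp add: E_add_const[OF H_cmult[OF NkH]] E_cmult[OF _ NkH] S_def prod_nonneg)
      also have "E (\<lambda>\<omega>'. N (Suc k) (pconcat (t k) \<omega> \<omega>')) = cexp E (t k) (cexp E (t (Suc k)) X) \<omega>"
        by (simp add: cexp_def[of E "t k"] N_def)
      also have "\<dots> = N k \<omega>"
        unfolding N_def using tk \<omega> X(1) t(2)[of k] Suc by (intro cexp_tower) auto
      finally show ?thesis by simp
    qed
    then have "E (cexp E (t k) (W (Suc k))) = E (W k)"
      using Suc by (intro E_cong cexp_H0 W_H0 tk) auto
    then show ?case using E_cexp[OF W_H0[OF Suc.prems] tk(1)] Suc by simp
  qed
  have S01: "0 \<le> S k \<omega>" "S k \<omega> \<le> 1" for k \<omega>
    unfolding S_def using f01 by (auto intro: prod_nonneg prod_le_1)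
  \<comment> \<open>The missing weight 1 - S k was removed at levels of at least c/2, while the
    remaining weight still carries \<open>N k\<close>. The induction step is \<open>f_prod\<close>
    multiplied by \<open>S k\<close>.\<close>
  have W_ge: "c / 2 * (1 - S k \<omega>) + S k \<omega> * N k \<omega> \<le> W k \<omega>" for k \<omega>
  proof (induction k)
    case 0
    show ?case using f_prod[of "N 0 \<omega>"] by (simp add: S_def W_def algebra_simps)
  next
    case (Suc k)
    have "S (Suc k) \<omega> = S k \<omega> * f (N (Suc k) \<omega>)" by (simp add: S_def mult.commute)
    moreover have "W (Suc k) \<omega> = W k \<omega> + S k \<omega> * (N (Suc k) \<omega> - N k \<omega>)" by (simp add: W_def)
    moreover have "0 \<le> S k \<omega> * ((1 - f (N (Suc k) \<omega>)) * (N (Suc k) \<omega> - c / 2))"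
      by (intro mult_nonneg_nonneg S01 f_prod)
    ultimately show ?case using Suc by (simp add: algebra_simps diff_divide_distrib)
  qed
  have W_nonneg: "0 \<le> W n \<omega>" if "\<omega> \<in> path_space T" for \<omega>
  proof -
    have "0 \<le> c / 2 * (1 - S n \<omega>) + S n \<omega> * N n \<omega>"
      using S01 N_nonneg[of n \<omega>] that \<open>0 < c\<close> by (intro add_nonneg_nonneg mult_nonneg_nonneg) auto
    then show ?thesis using W_ge[of n \<omega>] by linarith
  qed
  interpret prob_space P by (rule repr_prob_space[OF P])
  have W_int: "integrable P (W n)" by (rule repr_integrable[OF P W_H0]) simp
  \<comment> \<open>One passage above c makes a factor of \<open>S n\<close> zero: all the weight
    has been removed, at levels of at least c/2. Markov's inequality at this level yields the
    constant 2 / c.\<close>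
  have "{\<omega> \<in> path_space T. \<exists>j\<le>n. c < N j \<omega>} \<subseteq> {\<omega> \<in> space P. c / 2 \<le> W n \<omega>}"
  proof (safe, simp add: repr_space[OF P])
    fix \<omega> j assume "j \<le> n" "c < N j \<omega>"
    then have "S n \<omega> = 0" unfolding S_def using f_0 by (intro prod_zero) auto
    then show "c / 2 \<le> W n \<omega>" using W_ge[of n \<omega>] by simp
  qed
  then have "measure P {\<omega> \<in> path_space T. \<exists>j\<le>n. c < N j \<omega>} \<le> measure P {\<omega> \<in> space P. c / 2 \<le> W n \<omega>}"
    using borel_measurable_integrable[OF W_int] by (intro finite_measure_mono) auto
  also have "\<dots> \<le> (\<integral>\<omega>. W n \<omega> \<partial>P) / (c / 2)"
    using W_int W_nonneg \<open>0 < c\<close> by (intro integral_Markov_inequality_measure[where A="space P"]) (auto simp: repr_space[OF P] intro: sets.top[of P, unfolded repr_space[OF P]])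
  also have "\<dots> \<le> E X / (c / 2)"
    using repr_integral_le[OF P W_H0[of n]] E_W[of n] \<open>0 < c\<close> by (intro divide_right_mono) auto
  finally show ?thesis by (simp add: N_def mult.commute)
qed

text \<open>The discrete bound depends neither on the grid nor on P. By continuity in t, a strict
  inequality at some t persists at nearby dyadic multiples of T, so the event is the increasing
  union of its dyadic versions; this also makes it measurable.\<close>

lemma maximal_inequality:
  assumes X: "X \<in> H0 T" "\<And>\<omega>. \<omega> \<in> path_space T \<Longrightarrow> 0 \<le> X \<omega>" and "0 < c"
    and cont: "\<And>\<omega>. \<omega> \<in> path_space T \<Longrightarrow> continuous_on {0..T} (\<lambda>t. cexp E t X \<omega>)"
  shows "capacity \<P> {\<omega> \<in> path_space T. \<exists>t\<in>{0..T}. c < cexp E t X \<omega>} \<le> ennreal (2 * E X / c)"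
  unfolding capacity_def
proof (rule SUP_least)
  fix P assume P: "P \<in> \<P>"
  interpret prob_space P by (rule repr_prob_space[OF P])
  define A where "A n = {\<omega> \<in> path_space T. \<exists>j\<le>2 ^ n. c < cexp E (T * real j / 2 ^ n) X \<omega>}" for n :: nat
  have rng: "T * real j / 2 ^ n \<in> {0..T}" if "j \<le> 2 ^ n" for j n
  proof -
    have "real j \<le> 2 ^ n" using that by (metis of_nat_le_iff of_nat_numeral of_nat_power)
    then show ?thesis using T_pos by (simp add: field_simps)
  qed
  have A_sets: "A n \<in> sets P" for n
  proof -
    have "{\<omega> \<in> space P. c < cexp E (T * real j / 2 ^ n) X \<omega>} \<in> sets P" if "j \<le> 2 ^ n" for j
      using repr_integrable[OF P cexp_H0[OF X(1) rng[OF that]]] by measurable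
    then have "(\<Union>j\<le>2 ^ n. {\<omega> \<in> space P. c < cexp E (T * real j / 2 ^ n) X \<omega>}) \<in> sets P"
      by (intro sets.finite_UN) auto
    also have "(\<Union>j\<le>2 ^ n. {\<omega> \<in> space P. c < cexp E (T * real j / 2 ^ n) X \<omega>}) = A n"
      by (auto simp: A_def repr_space[OF P])
    finally show ?thesis .
  qed
  have "incseq A"
  proof (rule incseq_SucI, rule subsetI)
    fix n \<omega> assume "\<omega> \<in> A n"
    then obtain j where j: "j \<le> 2 ^ n" "\<omega> \<in> path_space T" "c < cexp E (T * real j / 2 ^ n) X \<omega>"
      unfolding A_def by auto
    moreover have "T * real j / 2 ^ n = T * real (2 * j) / 2 ^ Suc n" by simp
    ultimately show "\<omega> \<in> A (Suc n)" unfolding A_def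
      by (intro CollectI conjI exI[of _ "2 * j"]) (simp_all only: power_Suc mult_le_mono2)
  qed
  have "{\<omega> \<in> path_space T. \<exists>t\<in>{0..T}. c < cexp E t X \<omega>} = (\<Union>n. A n)"
  proof (intro equalityI subsetI)
    fix \<omega> assume "\<omega> \<in> {\<omega> \<in> path_space T. \<exists>t\<in>{0..T}. c < cexp E t X \<omega>}"
    then obtain t where t: "\<omega> \<in> path_space T" "t \<in> {0..T}" "c < cexp E t X \<omega>" by auto
    \<comment> \<open>Index of the largest grid point not above t, which misses t by at most T / 2 ^
      n.\<close>
    define j where "j n = nat \<lfloor>2 ^ n * (t / T)\<rfloor>" for n :: nat
    define u where "u n = T * real (j n) / 2 ^ n" for n
    have j: "real (j n) \<le> 2 ^ n * (t / T)" "2 ^ n * (t / T) - 1 \<le> real (j n)" for n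
    proof -
      have "0 \<le> 2 ^ n * (t / T)" using t T_pos by simp
      then show "real (j n) \<le> 2 ^ n * (t / T)" "2 ^ n * (t / T) - 1 \<le> real (j n)"
        unfolding j_def by linarith+
    qed
    have jle: "j n \<le> 2 ^ n" for n
    proof -
      have "2 ^ n * (t / T) \<le> 2 ^ n * 1" using t T_pos by (intro mult_left_mono) auto
      then have "real (j n) \<le> 2 ^ n" using j(1)[of n] by linarith
      then show ?thesis by (metis of_nat_le_iff of_nat_numeral of_nat_power)
    qed
    have u_bounds: "t - T * (1 / 2) ^ n \<le> u n" "u n \<le> t" for n
    proof -
      have "T * real (j n) \<le> T * (2 ^ n * (t / T))" "T * (2 ^ n * (t / T) - 1) \<le> T * real (j n)"
        using j[of n] T_pos by (intro mult_left_mono; simp)+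
      then have "T * real (j n) \<le> t * 2 ^ n" "t * 2 ^ n - T \<le> T * real (j n)"
        using T_pos by (simp_all add: right_diff_distrib mult.commute)
      then have "u n \<le> t" "(t * 2 ^ n - T) / 2 ^ n \<le> u n"
        unfolding u_def by (simp_all add: divide_le_eq divide_right_mono)
      then show "t - T * (1 / 2) ^ n \<le> u n" "u n \<le> t"
        by (simp_all add: diff_divide_distrib power_one_over)
    qed
    have "(\<lambda>n. (1 / 2 :: real) ^ n) \<longlonglongrightarrow> 0"
      by (rule LIMSEQ_power_zero) simp
    from tendsto_diff[OF tendsto_const tendsto_mult_left[OF this]]
    have lower: "(\<lambda>n. t - T * (1 / 2) ^ n) \<longlonglongrightarrow> t" by simp
    have "u \<longlonglongrightarrow> t"
      by (rule tendsto_sandwich[OF always_eventually always_eventually lower tendsto_const]) (intro allI u_bounds)+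
    then have "(\<lambda>n. cexp E (u n) X \<omega>) \<longlonglongrightarrow> cexp E t X \<omega>"
      by (rule continuous_on_tendsto_compose[OF cont[OF t(1)]]) (use t rng[OF jle] in \<open>auto simp: u_def\<close>)
    then have "\<forall>\<^sub>F n in sequentially. c < cexp E (u n) X \<omega>"
      using t(3) by (rule order_tendstoD)
    then obtain n where "c < cexp E (u n) X \<omega>" by (auto simp: eventually_sequentially)
    then have "\<omega> \<in> A n" using jle[of n] t(1) unfolding A_def u_def by blast
    then show "\<omega> \<in> (\<Union>n. A n)" by blast
  next
    fix \<omega> assume "\<omega> \<in> (\<Union>n. A n)"
    then show "\<omega> \<in> {\<omega> \<in> path_space T. \<exists>t\<in>{0..T}. c < cexp E t X \<omega>}"
      unfolding A_def using rng by blast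
  qed
  then have "emeasure P {\<omega> \<in> path_space T. \<exists>t\<in>{0..T}. c < cexp E t X \<omega>} = (SUP n. emeasure P (A n))"
    using A_sets \<open>incseq A\<close> by (simp add: SUP_emeasure_incseq image_subset_iff)
  also have "\<dots> \<le> ennreal (2 * E X / c)"
  proof (rule SUP_least)
    fix n :: nat
    have "T * real j / 2 ^ n \<le> T * real (Suc j) / 2 ^ n" for j
      using T_pos by (intro divide_right_mono mult_left_mono) auto
    then have "measure P (A n) \<le> 2 * E X / c"
      unfolding A_def using rng by (intro maximal_inequality_discrete[OF X \<open>0 < c\<close> _ _ P])
    then show "emeasure P (A n) \<le> ennreal (2 * E X / c)"
      by (simp add: emeasure_eq_measure ennreal_leI)
  qed
  finally show "emeasure P {\<omega> \<in> path_space T. \<exists>t\<in>{0..T}. c < cexp E t X \<omega>} \<le> ennreal (2 * E X / c)" .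
qed

end

section \<open>Lipschitz cylinder functions\<close>

text \<open>The constant is uniform, so that continuity in time needs only E|B_u - B_v|. The bound
  is stated on paths and not through \<open>\<phi>\<close>, so that functions with different time
  points combine by enlarging S.\<close>

definition lipschitz_cylinder :: "real \<Rightarrow> ('d::finite path \<Rightarrow> real) \<Rightarrow> bool"
  where "lipschitz_cylinder T X \<longleftrightarrow> X \<in> H0 T \<and>
    (\<exists>C S. 0 \<le> C \<and> finite S \<and> S \<subseteq> {0..T} \<and> (\<forall>\<omega>\<in>path_space T. \<forall>\<omega>'\<in>path_space T.
      \<bar>X \<omega> - X \<omega>'\<bar> \<le> C * (\<Sum>r\<in>S. norm (BM r \<omega> - BM r \<omega>'))))"

lemma lipschitz_cylinderE:
  assumes "lipschitz_cylinder T X"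
  obtains C S where "0 \<le> C" "finite S" "S \<subseteq> {0..T}"
    "\<forall>\<omega>\<in>path_space T. \<forall>\<omega>'\<in>path_space T.
      \<bar>X \<omega> - X \<omega>'\<bar> \<le> C * (\<Sum>r\<in>S. norm (BM r \<omega> - BM r \<omega>'))"
  using assms unfolding lipschitz_cylinder_def by blast

lemma lipschitz_cylinder_H0: "lipschitz_cylinder T X \<Longrightarrow> X \<in> H0 T"
  by (simp add: lipschitz_cylinder_def)

context G_space
begin

text \<open>The maximal inequality is applied to such differences, and their conditional
  expectations have to be continuous too.\<close>

lemma lipschitz_cylinder_abs_diff:
  fixes X Y :: "'d path \<Rightarrow> real"
  assumes "lipschitz_cylinder T X" "lipschitz_cylinder T Y"
  shows "lipschitz_cylinder T (\<lambda>\<omega>. \<bar>X \<omega> - Y \<omega>\<bar>)"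
proof -
  obtain C S where X: "0 \<le> C" "finite S" "S \<subseteq> {0..T}"
    "\<forall>\<omega>\<in>path_space T. \<forall>\<omega>'\<in>path_space T.
      \<bar>X \<omega> - X \<omega>'\<bar> \<le> C * (\<Sum>r\<in>S. norm (BM r \<omega> - BM r \<omega>'))"
    by (rule lipschitz_cylinderE[OF assms(1)]) (rule that)
  obtain D R where Y: "0 \<le> D" "finite R" "R \<subseteq> {0..T}"
    "\<forall>\<omega>\<in>path_space T. \<forall>\<omega>'\<in>path_space T.
      \<bar>Y \<omega> - Y \<omega>'\<bar> \<le> D * (\<Sum>r\<in>R. norm (BM r \<omega> - BM r \<omega>'))"
    by (rule lipschitz_cylinderE[OF assms(2)]) (rule that)
  have "\<bar>\<bar>X \<omega> - Y \<omega>\<bar> - \<bar>X \<omega>' - Y \<omega>'\<bar>\<bar> \<le> (C + D) * (\<Sum>r\<in>S \<union> R. norm (BM r \<omega> - BM r \<omega>'))"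
    if "\<omega> \<in> path_space T" "\<omega>' \<in> path_space T" for \<omega> \<omega>'
  proof -
    have "C * (\<Sum>r\<in>S. norm (BM r \<omega> - BM r \<omega>')) \<le> C * (\<Sum>r\<in>S \<union> R. norm (BM r \<omega> - BM r \<omega>'))"
      "D * (\<Sum>r\<in>R. norm (BM r \<omega> - BM r \<omega>')) \<le> D * (\<Sum>r\<in>S \<union> R. norm (BM r \<omega> - BM r \<omega>'))"
      using X Y by (auto intro!: mult_left_mono sum_mono2)
    then show ?thesis using bspec[OF bspec[OF X(4) that(1)] that(2)] bspec[OF bspec[OF Y(4) that(1)] that(2)]
      by (simp add: distrib_right)
  qed
  moreover have "(\<lambda>\<omega>. \<bar>X \<omega> - Y \<omega>\<bar>) \<in> H0 T"
    by (intro H0_abs H_diff lipschitz_cylinder_H0[OF assms(1)] lipschitz_cylinder_H0[OF assms(2)])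
  ultimately show ?thesis
    unfolding lipschitz_cylinder_def using X(1-3) Y(1-3)
    by (intro conjI exI[of _ "C + D"] exI[of _ "S \<union> R"]) auto
qed

lemma E_norm_BM_diff_abs:
  assumes "u \<in> {0..T}" "v \<in> {0..T}"
  shows "E (\<lambda>\<omega>. norm (BM u \<omega> - BM v \<omega>)) = sqrt \<bar>u - v\<bar> * e norm"
proof (cases "u \<le> v")
  case True
  then have "E (\<lambda>\<omega>. norm (BM v \<omega> - BM u \<omega>)) = sqrt (v - u) * e norm"
    using assms by (intro E_norm_BM_diff) auto
  moreover have "\<bar>u - v\<bar> = v - u" using True by simp
  ultimately show ?thesis by (simp only: norm_minus_commute[of "BM u _"])
next
  case False
  then show ?thesis using assms by (subst E_norm_BM_diff) auto
qed

text \<open>Both expectations run over the same continuation \<open>\<omega>'\<close>. At time r the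
  concatenated paths differ by an increment of \<open>\<omega>'\<close>, small in expectation by
  \<open>E_norm_BM_diff_abs\<close>, by at most the distance of the initial paths, and by an
  increment of the fixed path \<open>\<omega>0\<close>, small by its continuity.\<close>

lemma continuous_on_cexp:
  assumes "lipschitz_cylinder T X"
  shows "continuous_on (path_space T \<times> {0..T}) (\<lambda>(\<omega>, t). cexp E t X \<omega>)"
proof -
  obtain C S where X: "0 \<le> C" "finite S" "S \<subseteq> {0..T}"
    "\<forall>\<omega>\<in>path_space T. \<forall>\<omega>'\<in>path_space T.
      \<bar>X \<omega> - X \<omega>'\<bar> \<le> C * (\<Sum>r\<in>S. norm (BM r \<omega> - BM r \<omega>'))"
    by (rule lipschitz_cylinderE[OF assms(1)]) (rule that)
  have XH: "X \<in> H0 T" using assms by (rule lipschitz_cylinder_H0)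
  have bound: "\<bar>cexp E t X \<omega> - cexp E s X \<omega>0\<bar>
      \<le> C * (\<Sum>r\<in>S. (dist \<omega> \<omega>0 + norm (BM (min r t) \<omega>0 - BM (min r s) \<omega>0)) + sqrt \<bar>min r t - min r s\<bar> * e norm)"
    if "\<omega> \<in> path_space T" "\<omega>0 \<in> path_space T" "t \<in> {0..T}" "s \<in> {0..T}" for \<omega> \<omega>0 t s
  proof -
    let ?a = "\<lambda>r. dist \<omega> \<omega>0 + norm (BM (min r t) \<omega>0 - BM (min r s) \<omega>0)"
    let ?b = "\<lambda>r (\<omega>' :: 'd path). norm (BM (min r t) \<omega>' - BM (min r s) \<omega>')"
    have b: "?b r \<in> H0 T" if "r \<in> S" for r
      using X(3) that \<open>t \<in> {0..T}\<close> \<open>s \<in> {0..T}\<close> by (intro H0_norm_diff) auto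
    have ab: "(\<lambda>\<omega>'. ?b r \<omega>' + ?a r) \<in> H0 T" if "r \<in> S" for r
      by (rule H_add[OF b[OF that] H_const])
    have "\<bar>cexp E t X \<omega> - cexp E s X \<omega>0\<bar> \<le> E (\<lambda>\<omega>'. C * (\<Sum>r\<in>S. ?b r \<omega>' + ?a r))"
      unfolding cexp_def
    proof (rule E_abs_diff)
      fix \<omega>' :: "'d path" assume \<omega>': "\<omega>' \<in> path_space T"
      have "\<bar>X (pconcat t \<omega> \<omega>') - X (pconcat s \<omega>0 \<omega>')\<bar>
        \<le> C * (\<Sum>r\<in>S. norm (BM r (pconcat t \<omega> \<omega>') - BM r (pconcat s \<omega>0 \<omega>')))"
        using that \<omega>' by (intro X(4)[rule_format]) auto
      also have "\<dots> \<le> C * (\<Sum>r\<in>S. ?b r \<omega>' + ?a r)"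
      proof (intro mult_left_mono sum_mono X(1))
        fix r
        have eq: "BM r (pconcat t \<omega> \<omega>') - BM r (pconcat s \<omega>0 \<omega>')
          = (BM (min r s) \<omega>' - BM (min r t) \<omega>') + ((BM (min r t) \<omega> - BM (min r t) \<omega>0) + (BM (min r t) \<omega>0 - BM (min r s) \<omega>0))"
          by (simp add: BM_pconcat)
        have "norm (BM (min r t) \<omega> - BM (min r t) \<omega>0) \<le> dist \<omega> \<omega>0"
          using dist_bounded[of \<omega> "min r t" \<omega>0] by (simp add: dist_norm)
        then show "norm (BM r (pconcat t \<omega> \<omega>') - BM r (pconcat s \<omega>0 \<omega>')) \<le> ?b r \<omega>' + ?a r"
          unfolding eq
          using norm_triangle_ineq[of "BM (min r s) \<omega>' - BM (min r t) \<omega>'"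
              "(BM (min r t) \<omega> - BM (min r t) \<omega>0) + (BM (min r t) \<omega>0 - BM (min r s) \<omega>0)"]
            norm_triangle_ineq[of "BM (min r t) \<omega> - BM (min r t) \<omega>0" "BM (min r t) \<omega>0 - BM (min r s) \<omega>0"]
            norm_minus_commute[of "BM (min r s) \<omega>'" "BM (min r t) \<omega>'"]
          by linarith
      qed
      finally show "\<bar>X (pconcat t \<omega> \<omega>') - X (pconcat s \<omega>0 \<omega>')\<bar> \<le> C * (\<Sum>r\<in>S. ?b r \<omega>' + ?a r)" .
    qed (use that XH in \<open>intro H0_pconcat H_cmult H_sum ab; simp\<close>)+
    also have "\<dots> = C * E (\<lambda>\<omega>'. \<Sum>r\<in>S. ?b r \<omega>' + ?a r)"
      by (intro E_cmult X(1) H_sum ab)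
    also have "\<dots> \<le> C * (\<Sum>r\<in>S. E (\<lambda>\<omega>'. ?b r \<omega>' + ?a r))"
      by (intro mult_left_mono E_sum ab X(1))
    also have "(\<Sum>r\<in>S. E (\<lambda>\<omega>'. ?b r \<omega>' + ?a r)) = (\<Sum>r\<in>S. ?a r + sqrt \<bar>min r t - min r s\<bar> * e norm)"
    proof (rule sum.cong[OF refl])
      fix r assume r: "r \<in> S"
      then have "min r t \<in> {0..T}" "min r s \<in> {0..T}" using X(3) that by auto
      then show "E (\<lambda>\<omega>'. ?b r \<omega>' + ?a r) = ?a r + sqrt \<bar>min r t - min r s\<bar> * e norm"
        using E_add_const[OF b[OF r]] E_norm_BM_diff_abs by simp
    qed
    finally show ?thesis .
  qed
  show ?thesis
    unfolding continuous_on_def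
  proof (safe)
    fix \<omega>0 :: "'d path" and s assume \<omega>0: "\<omega>0 \<in> path_space T" and s: "s \<in> {0..T}"
    let ?F = "at (\<omega>0, s) within path_space T \<times> {0..T}"
    let ?h = "\<lambda>(\<omega> :: 'd path, t). C * (\<Sum>r\<in>S. (dist \<omega> \<omega>0 + norm (BM (min r t) \<omega>0 - BM (min r s) \<omega>0)) + sqrt \<bar>min r t - min r s\<bar> * e norm)"
    have c: "continuous_on A (\<lambda>p :: 'd path \<times> real. BM (min r (snd p)) \<omega>0)" for r A
      by (intro continuous_on_compose2[OF continuous_on_apply_bcontfun[of UNIV \<omega>0]] continuous_intros) auto
    have "continuous_on (path_space T \<times> {0..T}) ?h"
      unfolding case_prod_unfold by (intro continuous_intros c)
    then have "(?h \<longlongrightarrow> ?h (\<omega>0, s)) ?F"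
      unfolding continuous_on_def by (rule bspec) (simp add: \<omega>0 s[simplified])
    then have h0: "(?h \<longlongrightarrow> 0) ?F" by simp
    have "((\<lambda>p. (case p of (\<omega>, t) \<Rightarrow> cexp E t X \<omega>) - cexp E s X \<omega>0) \<longlongrightarrow> 0) ?F"
    proof (rule Lim_null_comparison[OF _ h0])
      show "\<forall>\<^sub>F p in ?F. norm ((case p of (\<omega>, t) \<Rightarrow> cexp E t X \<omega>) - cexp E s X \<omega>0) \<le> ?h p"
        unfolding eventually_at_filter
        by (intro always_eventually) (use bound \<omega>0 s in auto)
    qed
    then show "((\<lambda>(\<omega>, t). cexp E t X \<omega>) \<longlongrightarrow> cexp E s X \<omega>0) ?F"
      by (simp add: LIM_zero_iff)
  qed
qed

text \<open>Clipping every component to the ball of radius N bounds the polynomial factor, which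
  makes the function Lipschitz. An error occurs only where |x| > N; there 1 < |x| / N, so one more
  power of |x| buys a factor 1 / N.\<close>

lemma lipschitz_approximation:
  fixes X :: "'d path \<Rightarrow> real"
  assumes "X \<in> H0 T" "0 < \<epsilon>"
  obtains Y where "lipschitz_cylinder T Y" "E (\<lambda>\<omega>. \<bar>X \<omega> - Y \<omega>\<bar>) \<le> \<epsilon>"
proof -
  obtain n t \<phi> where X: "1 \<le> n" "\<And>i. i < n \<Longrightarrow> t i \<in> {0..T}" "\<phi> \<in> C_lLip n"
    "\<And>\<omega>. \<omega> \<in> path_space T \<Longrightarrow> X \<omega> = \<phi> (\<lambda>i. BM (t i) \<omega>)"
    using H0E[OF assms(1)] by metis
  obtain C k where C: "0 \<le> C" "\<And>x y. \<bar>\<phi> x - \<phi> y\<bar> \<le> C * (1 + vnorm n x + vnorm n y) ^ k * vnorm n (\<lambda>i. x i - y i)"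
    using C_lLipE[OF X(3)] by metis
  \<comment> \<open>The growth bound C (1 + 2|x|)^k 2|x| for the clipping error, times the extra
    |x|.\<close>
  define \<zeta> where "\<zeta> x = C * (1 + 2 * vnorm n x) ^ k * (2 * vnorm n x ^ 2)" for x :: "nat \<Rightarrow> real^'d"
  have "\<zeta> \<in> C_lLip n"
    unfolding \<zeta>_def[abs_def] by (intro C_lLip_mult C_lLip_power C_lLip_add C_lLip_const C_lLip_vnorm)
  then have Z: "(\<lambda>\<omega>. \<zeta> (\<lambda>i. BM (t i) \<omega>)) \<in> H0 T"
    by (intro H0I[OF X(1,2)]) auto
  let ?Z = "\<lambda>\<omega>. \<zeta> (\<lambda>i. BM (t i) \<omega>)"
  have Z_nonneg: "0 \<le> \<zeta> x" for x using C(1) by (simp add: \<zeta>_def)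
  \<comment> \<open>Large enough for the error bound \<open>E ?Z / N\<close> to be at most
    \<epsilon>; the 1 keeps N positive.\<close>
  define N where "N = max 1 (E ?Z / \<epsilon>)"
  have N: "0 < N" "E ?Z / N \<le> \<epsilon>"
  proof -
    show "0 < N" by (simp add: N_def)
    have "E ?Z / \<epsilon> \<le> N" by (simp add: N_def)
    then show "E ?Z / N \<le> \<epsilon>" using \<open>0 < N\<close> assms(2) by (simp add: field_simps)
  qed
  \<comment> \<open>The projection onto a closed convex set is nonexpansive, so composing with it
    stays in \<open>C_lLip\<close>.\<close>
  define clip where "clip = closest_point (cball (0::real^'d) N)"
  have clip_lip: "norm (clip u - clip v) \<le> norm (u - v)" for u v
    unfolding clip_def using closest_point_lipschitz[of "cball (0::real^'d) N" u v] N by (simp add: dist_norm)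
  have clip_id: "clip v = v" if "norm v \<le> N" for v
    unfolding clip_def using that by (intro closest_point_self) simp
  have clip_N: "norm (clip v) \<le> N" for v
    unfolding clip_def using closest_point_in_set[of "cball (0::real^'d) N" v] N by simp
  have clip_le: "norm (clip v) \<le> norm v" for v
    using clip_lip[of v 0] clip_id[of 0] N by simp
  have \<psi>: "(\<lambda>x. \<phi> (\<lambda>i. clip (x i))) \<in> C_lLip n"
  proof (rule C_lLip_compose[OF X(3), of 1])
    fix x y :: "nat \<Rightarrow> real^'d" and i assume "i < n"
    then show "norm (clip (x i) - clip (y i)) \<le> 1 * vnorm n (\<lambda>j. x j - y j)"
      using clip_lip[of "x i" "y i"] norm_le_vnorm[of i n "\<lambda>j. x j - y j"] by simp
  qed auto
  define Y where "Y \<omega> = \<phi> (\<lambda>i. clip (BM (t i) \<omega>))" for \<omega>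
  have Y_H0: "Y \<in> H0 T"
    by (rule H0I[OF X(1,2) \<psi>]) (auto simp: Y_def)
  define K where "K = C * (1 + n * N + n * N) ^ k"
  have K: "0 \<le> K" using C(1) N by (simp add: K_def)
  have "\<bar>Y \<omega> - Y \<omega>'\<bar> \<le> (K * n) * (\<Sum>r\<in>t ` {..<n}. norm (BM r \<omega> - BM r \<omega>'))" for \<omega> \<omega>'
  proof -
    let ?x = "\<lambda>i. clip (BM (t i) \<omega>)" and ?y = "\<lambda>i. clip (BM (t i) \<omega>')"
    have "vnorm n ?x \<le> n * N" "vnorm n ?y \<le> n * N"
      by (intro vnorm_le_bound clip_N)+
    then have "C * (1 + vnorm n ?x + vnorm n ?y) ^ k * vnorm n (\<lambda>i. ?x i - ?y i) \<le> K * vnorm n (\<lambda>i. ?x i - ?y i)"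
      unfolding K_def using C(1) by (intro mult_right_mono mult_left_mono power_mono add_mono) auto
    also have "\<dots> \<le> K * (n * (\<Sum>r\<in>t ` {..<n}. norm (BM r \<omega> - BM r \<omega>')))"
    proof (intro mult_left_mono K vnorm_le_bound)
      fix i assume "i < n"
      then have "norm (BM (t i) \<omega> - BM (t i) \<omega>') \<le> (\<Sum>r\<in>t ` {..<n}. norm (BM r \<omega> - BM r \<omega>'))"
        by (intro member_le_sum[where f="\<lambda>r. norm (BM r \<omega> - BM r \<omega>')"]) auto
      then show "norm (?x i - ?y i) \<le> (\<Sum>r\<in>t ` {..<n}. norm (BM r \<omega> - BM r \<omega>'))"
        using clip_lip[of "BM (t i) \<omega>" "BM (t i) \<omega>'"] by linarith
    qed
    finally show ?thesis using C(2)[of ?x ?y] by (simp add: Y_def mult.assoc)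
  qed
  then have "lipschitz_cylinder T Y"
    unfolding lipschitz_cylinder_def using Y_H0 K X(2)
    by (intro conjI exI[of _ "K * n"] exI[of _ "t ` {..<n}"]) auto
  moreover have "E (\<lambda>\<omega>. \<bar>X \<omega> - Y \<omega>\<bar>) \<le> \<epsilon>"
  proof -
    have "\<bar>\<phi> x - \<phi> (\<lambda>i. clip (x i))\<bar> \<le> 1 / N * \<zeta> x" for x
    proof (cases "vnorm n x \<le> N")
      case True
      have "clip (x i) = x i" if "i < n" for i
        using norm_le_vnorm[OF that, of x] True by (intro clip_id) simp
      then have "\<phi> x = \<phi> (\<lambda>i. clip (x i))"
        by (intro C_lLip_cong_arg[OF X(3)]) simp
      then show ?thesis using Z_nonneg N by simp
    next
      case False
      let ?V = "vnorm n x"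
      have 1: "vnorm n (\<lambda>i. clip (x i)) \<le> ?V"
        unfolding vnorm_def by (intro L2_set_mono) (auto intro: clip_le)
      have 2: "vnorm n (\<lambda>i. x i - clip (x i)) \<le> 2 * ?V"
      proof -
        have "vnorm n (\<lambda>i. - clip (x i)) = vnorm n (\<lambda>i. clip (x i))" by (simp add: vnorm_def)
        then show ?thesis using vnorm_triangle[of n x "\<lambda>i. - clip (x i)"] 1 by simp
      qed
      have 3: "?V \<le> 1 / N * ?V ^ 2"
        using False N mult_right_mono[of N ?V ?V] by (simp add: field_simps power2_eq_square)
      have "\<bar>\<phi> x - \<phi> (\<lambda>i. clip (x i))\<bar> \<le> C * (1 + ?V + vnorm n (\<lambda>i. clip (x i))) ^ k * vnorm n (\<lambda>i. x i - clip (x i))"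
        by (rule C)
      also have "\<dots> \<le> C * (1 + 2 * ?V) ^ k * (2 * ?V)"
        using 1 2 C(1) by (intro mult_mono mult_left_mono power_mono) auto
      also have "\<dots> \<le> C * (1 + 2 * ?V) ^ k * (2 * (1 / N * ?V ^ 2))"
        using 3 C(1) by (intro mult_left_mono) auto
      finally show ?thesis by (simp add: \<zeta>_def mult_ac)
    qed
    then have "E (\<lambda>\<omega>. \<bar>X \<omega> - Y \<omega>\<bar>) \<le> E (\<lambda>\<omega>. 1 / N * ?Z \<omega>)"
      by (intro E_mono H0_abs H_diff H_cmult Z Y_H0 assms(1)) (simp add: X(4) Y_def)
    also have "\<dots> = 1 / N * E ?Z"
      using N by (intro E_cmult Z) simp
    finally show ?thesis using N(2) by simp
  qed
  ultimately show ?thesis using that by blast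
qed

end

section \<open>Limits of conditional expectations\<close>

text \<open>2 (1/2)^k is the sum of the bounds of all steps from index k on.\<close>

lemma geometric_steps_convergent:
  fixes a :: "nat \<Rightarrow> real"
  assumes step: "\<And>k. m \<le> k \<Longrightarrow> \<bar>a (Suc k) - a k\<bar> \<le> (1 / 2) ^ k"
  shows "convergent a" and "m \<le> k \<Longrightarrow> \<bar>a k - lim a\<bar> \<le> 2 * (1 / 2) ^ k"
proof -
  \<comment> \<open>Subtracting the tail that is still to come makes the bound telescope in
    j.\<close>
  have *: "\<bar>a (k + j) - a k\<bar> \<le> 2 * (1 / 2) ^ k - 2 * (1 / 2) ^ (k + j)" if "m \<le> k" for k j
  proof (induction j)
    case (Suc j)
    have "\<bar>a (Suc (k + j)) - a (k + j)\<bar> \<le> (1 / 2) ^ (k + j)" using that by (intro step) simp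
    with Suc show ?case by simp
  qed simp
  have le: "\<bar>a (k + j) - a k\<bar> \<le> 2 * (1 / 2) ^ k" if "m \<le> k" for k j
    using *[OF that, of j] zero_le_power[of "1 / 2 :: real" "k + j"] by linarith
  have "Cauchy a"
  proof (rule metric_CauchyI)
    fix \<epsilon> :: real assume "0 < \<epsilon>"
    have "(\<lambda>k. 2 * (1 / 2 :: real) ^ k) \<longlonglongrightarrow> 2 * 0"
      by (intro tendsto_mult_left LIMSEQ_power_zero) simp
    then have "\<forall>\<^sub>F k in sequentially. 2 * (1 / 2 :: real) ^ k < \<epsilon> / 2"
      using \<open>0 < \<epsilon>\<close> by (intro order_tendstoD(2)[where y=0]) simp_all
    then obtain k where k: "m \<le> k" "2 * (1 / 2 :: real) ^ k < \<epsilon> / 2"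
      unfolding eventually_sequentially by (meson nat_le_linear)
    have "\<bar>a i - a k\<bar> < \<epsilon> / 2" if "k \<le> i" for i
      using le[OF k(1), of "i - k"] k(2) that by simp
    then have "dist (a i) (a j) < \<epsilon>" if "k \<le> i" "k \<le> j" for i j
      using that dist_triangle_half_l[of "a i" "a k" \<epsilon> "a j"] by (simp add: dist_real_def)
    then show "\<exists>M. \<forall>i\<ge>M. \<forall>j\<ge>M. dist (a i) (a j) < \<epsilon>" by blast
  qed
  then show "convergent a" by (rule Cauchy_convergent)
  then have "a \<longlonglongrightarrow> lim a" by (simp add: convergent_LIMSEQ_iff)
  then have "(\<lambda>j. \<bar>a (j + k) - a k\<bar>) \<longlonglongrightarrow> \<bar>lim a - a k\<bar>"
    by (intro tendsto_rabs tendsto_diff tendsto_const LIMSEQ_ignore_initial_segment)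
  then show "\<bar>a k - lim a\<bar> \<le> 2 * (1 / 2) ^ k" if "m \<le> k"
    using le[OF that] by (subst abs_minus_commute, intro LIMSEQ_le_const2) (auto simp: add.commute)
qed

context G_space_repr
begin

section \<open>The norm of L^1_G and conditional expectations\<close>

lemma norm1_least: "(\<And>P. P \<in> \<P> \<Longrightarrow> (\<integral>\<^sup>+\<omega>. ennreal \<bar>X \<omega>\<bar> \<partial>P) \<le> c) \<Longrightarrow> norm1 \<P> X \<le> c"
  unfolding norm1_def by (rule SUP_least)

lemma norm1_upper: "P \<in> \<P> \<Longrightarrow> (\<integral>\<^sup>+\<omega>. ennreal \<bar>X \<omega>\<bar> \<partial>P) \<le> norm1 \<P> X"
  unfolding norm1_def by (rule SUP_upper)

lemma norm1_H0:
  assumes "X \<in> H0 T"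
  shows "norm1 \<P> X = ennreal (E (\<lambda>\<omega>. \<bar>X \<omega>\<bar>))"
proof (rule antisym)
  have nn: "(\<integral>\<^sup>+\<omega>. ennreal \<bar>X \<omega>\<bar> \<partial>P) = ennreal (\<integral>\<omega>. \<bar>X \<omega>\<bar> \<partial>P)" if "P \<in> \<P>" for P
    using repr_integrable[OF that H0_abs[OF assms]] by (intro nn_integral_eq_integral) auto
  show "norm1 \<P> X \<le> ennreal (E (\<lambda>\<omega>. \<bar>X \<omega>\<bar>))"
    using repr_integral_le[OF _ H0_abs[OF assms]] by (intro norm1_least) (simp add: nn ennreal_leI)
  show "ennreal (E (\<lambda>\<omega>. \<bar>X \<omega>\<bar>)) \<le> norm1 \<P> X"
    using repr_attained[OF H0_abs[OF assms]] norm1_upper[of _ X] nn by metis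
qed

lemma norm1_mono:
  assumes "\<And>\<omega>. \<omega> \<in> path_space T \<Longrightarrow> \<bar>X \<omega>\<bar> \<le> \<bar>Y \<omega>\<bar>"
  shows "norm1 \<P> X \<le> norm1 \<P> Y"
proof (rule norm1_least)
  fix P assume P: "P \<in> \<P>"
  have "(\<integral>\<^sup>+\<omega>. ennreal \<bar>X \<omega>\<bar> \<partial>P) \<le> (\<integral>\<^sup>+\<omega>. ennreal \<bar>Y \<omega>\<bar> \<partial>P)"
    using assms by (intro nn_integral_mono ennreal_leI) (simp add: repr_space[OF P])
  also have "\<dots> \<le> norm1 \<P> Y" by (rule norm1_upper[OF P])
  finally show "(\<integral>\<^sup>+\<omega>. ennreal \<bar>X \<omega>\<bar> \<partial>P) \<le> norm1 \<P> Y" .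
qed

lemma norm1_commute: "norm1 \<P> (\<lambda>\<omega>. X \<omega> - Y \<omega>) = norm1 \<P> (\<lambda>\<omega>. Y \<omega> - X \<omega>)"
  by (simp add: norm1_def abs_minus_commute)

lemma norm1_triangle:
  assumes [measurable]: "X \<in> borel_measurable paths" "Y \<in> borel_measurable paths" "Z \<in> borel_measurable paths"
  shows "norm1 \<P> (\<lambda>\<omega>. X \<omega> - Z \<omega>) \<le> norm1 \<P> (\<lambda>\<omega>. X \<omega> - Y \<omega>) + norm1 \<P> (\<lambda>\<omega>. Y \<omega> - Z \<omega>)"
proof (rule norm1_least)
  fix P assume P: "P \<in> \<P>"
  note [measurable_cong] = repr_sets[OF P]
  have "(\<integral>\<^sup>+\<omega>. ennreal \<bar>X \<omega> - Z \<omega>\<bar> \<partial>P) \<le> (\<integral>\<^sup>+\<omega>. ennreal \<bar>X \<omega> - Y \<omega>\<bar> + ennreal \<bar>Y \<omega> - Z \<omega>\<bar> \<partial>P)"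
    by (intro nn_integral_mono) (auto simp: ennreal_plus[symmetric] simp del: ennreal_plus intro!: ennreal_leI)
  also have "\<dots> = (\<integral>\<^sup>+\<omega>. ennreal \<bar>X \<omega> - Y \<omega>\<bar> \<partial>P) + (\<integral>\<^sup>+\<omega>. ennreal \<bar>Y \<omega> - Z \<omega>\<bar> \<partial>P)"
    by (intro nn_integral_add) measurable
  also have "\<dots> \<le> norm1 \<P> (\<lambda>\<omega>. X \<omega> - Y \<omega>) + norm1 \<P> (\<lambda>\<omega>. Y \<omega> - Z \<omega>)"
    by (intro add_mono norm1_upper P)
  finally show "(\<integral>\<^sup>+\<omega>. ennreal \<bar>X \<omega> - Z \<omega>\<bar> \<partial>P) \<le> norm1 \<P> (\<lambda>\<omega>. X \<omega> - Y \<omega>) + norm1 \<P> (\<lambda>\<omega>. Y \<omega> - Z \<omega>)" .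
qed

lemma L1G_measurable: "X \<in> L1G T \<P> \<Longrightarrow> X \<in> borel_measurable paths"
  by (simp add: L1G_def)

text \<open>The difference is dominated by E_s|X - Y|, whose G-expectation is that of |X - Y| by
  \<open>E_cexp\<close>.\<close>

lemma norm1_cexp_diff:
  assumes "X \<in> H0 T" "Y \<in> H0 T" "s \<in> {0..T}"
  shows "norm1 \<P> (\<lambda>\<omega>. cexp E s X \<omega> - cexp E s Y \<omega>) \<le> norm1 \<P> (\<lambda>\<omega>. X \<omega> - Y \<omega>)"
proof -
  let ?D = "\<lambda>\<omega>. \<bar>X \<omega> - Y \<omega>\<bar>"
  have D: "?D \<in> H0 T" using assms by (intro H0_abs H_diff)
  have nonneg: "0 \<le> cexp E s ?D \<omega>" if "\<omega> \<in> path_space T" for \<omega>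
    unfolding cexp_def using assms that by (intro E_nonneg H0_pconcat[OF D]) auto
  have "norm1 \<P> (\<lambda>\<omega>. cexp E s X \<omega> - cexp E s Y \<omega>) \<le> norm1 \<P> (cexp E s ?D)"
    using cexp_abs_diff[OF assms] nonneg by (intro norm1_mono) simp
  also have "\<dots> = ennreal (E (\<lambda>\<omega>. \<bar>cexp E s ?D \<omega>\<bar>))"
    by (rule norm1_H0[OF cexp_H0[OF D assms(3)]])
  also have "E (\<lambda>\<omega>. \<bar>cexp E s ?D \<omega>\<bar>) = E (cexp E s ?D)"
    by (intro E_cong H0_abs cexp_H0 D assms(3)) (simp add: nonneg)
  also have "\<dots> = E ?D" by (rule E_cexp[OF D assms(3)])
  also have "ennreal (E ?D) = norm1 \<P> (\<lambda>\<omega>. X \<omega> - Y \<omega>)"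
    using assms by (intro norm1_H0[symmetric] H_diff)
  finally show ?thesis .
qed

text \<open>\<open>cond_expectation\<close> only asserts that some approximating sequence exists. By
  contraction, E_s \<zeta> is at least as close to \<open>\<eta> n\<close> as \<zeta> is to
  \<open>\<xi> n\<close>; then n tends to infinity. For X = M_T the bound is the same for all
  s.\<close>

lemma norm1_cexp_cond_expectation:
  assumes "cond_expectation T E \<P> s X Y" "\<zeta> \<in> H0 T"
  shows "norm1 \<P> (\<lambda>\<omega>. cexp E s \<zeta> \<omega> - Y \<omega>) \<le> norm1 \<P> (\<lambda>\<omega>. \<zeta> \<omega> - X \<omega>)"
proof -
  have X[measurable]: "X \<in> borel_measurable paths" and Y[measurable]: "Y \<in> borel_measurable paths"
    using assms(1) unfolding cond_expectation_def by (auto intro: L1G_measurable)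
  obtain \<xi> \<eta> where c: "\<And>n. cond_cylinder T E s (\<xi> n) (\<eta> n)"
    and \<xi>: "(\<lambda>n. norm1 \<P> (\<lambda>\<omega>. \<xi> n \<omega> - X \<omega>)) \<longlonglongrightarrow> 0"
    and \<eta>: "(\<lambda>n. norm1 \<P> (\<lambda>\<omega>. \<eta> n \<omega> - Y \<omega>)) \<longlonglongrightarrow> 0"
    using assms(1) unfolding cond_expectation_def by blast
  note cc = cond_cylinder_cexp[OF c]
  have \<eta>_H0: "\<eta> n \<in> H0 T" for n
    by (rule H0_cong[OF cexp_H0[OF cc(1,2)] cc(3)])
  note meas = H0_measurable[OF \<eta>_H0] H0_measurable[OF cc(1)] H0_measurable[OF assms(2)]
    H0_measurable[OF cexp_H0[OF assms(2) cc(2)]]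
  have "norm1 \<P> (\<lambda>\<omega>. cexp E s \<zeta> \<omega> - Y \<omega>)
    \<le> (norm1 \<P> (\<lambda>\<omega>. \<zeta> \<omega> - X \<omega>) + norm1 \<P> (\<lambda>\<omega>. \<xi> n \<omega> - X \<omega>)) + norm1 \<P> (\<lambda>\<omega>. \<eta> n \<omega> - Y \<omega>)" for n
  proof -
    have "norm1 \<P> (\<lambda>\<omega>. cexp E s \<zeta> \<omega> - Y \<omega>)
      \<le> norm1 \<P> (\<lambda>\<omega>. cexp E s \<zeta> \<omega> - \<eta> n \<omega>) + norm1 \<P> (\<lambda>\<omega>. \<eta> n \<omega> - Y \<omega>)"
      by (intro norm1_triangle Y meas)
    also have "norm1 \<P> (\<lambda>\<omega>. cexp E s \<zeta> \<omega> - \<eta> n \<omega>) \<le> norm1 \<P> (\<lambda>\<omega>. cexp E s \<zeta> \<omega> - cexp E s (\<xi> n) \<omega>)"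
      by (intro norm1_mono) (simp add: cc(3))
    also have "\<dots> \<le> norm1 \<P> (\<lambda>\<omega>. \<zeta> \<omega> - \<xi> n \<omega>)"
      by (rule norm1_cexp_diff[OF assms(2) cc(1,2)])
    also have "\<dots> \<le> norm1 \<P> (\<lambda>\<omega>. \<zeta> \<omega> - X \<omega>) + norm1 \<P> (\<lambda>\<omega>. X \<omega> - \<xi> n \<omega>)"
      by (intro norm1_triangle X meas)
    finally show ?thesis by (simp add: norm1_commute[of X] add_right_mono)
  qed
  moreover have "(\<lambda>n. (norm1 \<P> (\<lambda>\<omega>. \<zeta> \<omega> - X \<omega>) + norm1 \<P> (\<lambda>\<omega>. \<xi> n \<omega> - X \<omega>)) + norm1 \<P> (\<lambda>\<omega>. \<eta> n \<omega> - Y \<omega>))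
      \<longlonglongrightarrow> (norm1 \<P> (\<lambda>\<omega>. \<zeta> \<omega> - X \<omega>) + 0) + 0"
    by (intro tendsto_add tendsto_const \<xi> \<eta>)
  ultimately show ?thesis
    by (metis (no_types, lifting) LIMSEQ_le_const add.right_neutral)
qed

lemma lipschitz_dense:
  assumes "X \<in> L1G T \<P>" "0 < \<epsilon>"
  obtains Y where "lipschitz_cylinder T Y" "norm1 \<P> (\<lambda>\<omega>. Y \<omega> - X \<omega>) \<le> ennreal \<epsilon>"
proof -
  obtain \<xi> where \<xi>: "\<And>n. \<xi> n \<in> H0 T" "(\<lambda>n. norm1 \<P> (\<lambda>\<omega>. \<xi> n \<omega> - X \<omega>)) \<longlonglongrightarrow> 0"
    using assms(1) unfolding L1G_def by blast
  have "\<forall>\<^sub>F n in sequentially. norm1 \<P> (\<lambda>\<omega>. \<xi> n \<omega> - X \<omega>) < ennreal (\<epsilon> / 2)"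
    using assms(2) by (intro order_tendstoD(2)[OF \<xi>(2)]) simp
  then obtain n where n: "norm1 \<P> (\<lambda>\<omega>. \<xi> n \<omega> - X \<omega>) < ennreal (\<epsilon> / 2)"
    by (auto simp: eventually_sequentially)
  obtain Y where Y: "lipschitz_cylinder T Y" "E (\<lambda>\<omega>. \<bar>\<xi> n \<omega> - Y \<omega>\<bar>) \<le> \<epsilon> / 2"
    using lipschitz_approximation[OF \<xi>(1), of "\<epsilon> / 2" n] assms(2) by auto
  have YH: "Y \<in> H0 T" by (rule lipschitz_cylinder_H0[OF Y(1)])
  have "norm1 \<P> (\<lambda>\<omega>. Y \<omega> - X \<omega>) \<le> norm1 \<P> (\<lambda>\<omega>. Y \<omega> - \<xi> n \<omega>) + norm1 \<P> (\<lambda>\<omega>. \<xi> n \<omega> - X \<omega>)"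
    by (intro norm1_triangle H0_measurable YH \<xi> L1G_measurable assms)
  also have "\<dots> \<le> ennreal (\<epsilon> / 2) + ennreal (\<epsilon> / 2)"
  proof (rule add_mono)
    have "norm1 \<P> (\<lambda>\<omega>. Y \<omega> - \<xi> n \<omega>) = ennreal (E (\<lambda>\<omega>. \<bar>\<xi> n \<omega> - Y \<omega>\<bar>))"
      unfolding norm1_commute[of Y] by (intro norm1_H0 H_diff YH \<xi>)
    then show "norm1 \<P> (\<lambda>\<omega>. Y \<omega> - \<xi> n \<omega>) \<le> ennreal (\<epsilon> / 2)"
      using Y(2) by (simp add: ennreal_leI)
    show "norm1 \<P> (\<lambda>\<omega>. \<xi> n \<omega> - X \<omega>) \<le> ennreal (\<epsilon> / 2)" using n by simp
  qed
  also have "\<dots> = ennreal \<epsilon>"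
    using assms(2) by (simp add: ennreal_plus[symmetric] del: ennreal_plus)
  finally show ?thesis using that Y(1) by blast
qed

section \<open>Capacity and the identification of limits\<close>

lemma capacity_mono:
  assumes "A \<subseteq> B" "B \<in> sets paths"
  shows "capacity \<P> A \<le> capacity \<P> B"
  unfolding capacity_def using assms repr_sets by (intro SUP_mono) (metis emeasure_mono)

lemma capacity_countable_subadditive:
  assumes "\<And>i. A i \<in> sets paths"
  shows "capacity \<P> (\<Union>i::nat. A i) \<le> (\<Sum>i. capacity \<P> (A i))"
proof (subst capacity_def, rule SUP_least)
  fix P assume P: "P \<in> \<P>"
  have "emeasure P (\<Union>i. A i) \<le> (\<Sum>i. emeasure P (A i))"
    using assms repr_sets[OF P] by (intro emeasure_subadditive_countably) auto
  also have "\<dots> \<le> (\<Sum>i. capacity \<P> (A i))"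
    unfolding capacity_def using P by (intro suminf_le SUP_upper) auto
  finally show "emeasure P (\<Union>i. A i) \<le> (\<Sum>i. capacity \<P> (A i))" .
qed

lemma openin_sets_paths:
  assumes "openin (top_of_set (path_space T)) U"
  shows "U \<in> sets paths"
  using assms by (auto simp: openin_open sets_restrict_space)

text \<open>Fatou's lemma under P: the integral of |X - Y| is at most the lower limit of the norms,
  so no subsequence has to be extracted.\<close>

lemma AE_eq_of_norm1:
  assumes u: "\<And>k. u k \<in> borel_measurable paths" and X: "X \<in> borel_measurable paths" and Y: "Y \<in> borel_measurable paths"
    and lim: "(\<lambda>k. norm1 \<P> (\<lambda>\<omega>. u k \<omega> - Y \<omega>)) \<longlonglongrightarrow> 0"
    and P: "P \<in> \<P>" and AE: "AE \<omega> in P. (\<lambda>k. u k \<omega>) \<longlonglongrightarrow> X \<omega>"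
  shows "AE \<omega> in P. X \<omega> = Y \<omega>"
proof -
  note [measurable] = u X Y and [measurable_cong] = repr_sets[OF P]
  have "(\<integral>\<^sup>+\<omega>. ennreal \<bar>X \<omega> - Y \<omega>\<bar> \<partial>P) = (\<integral>\<^sup>+\<omega>. liminf (\<lambda>k. ennreal \<bar>u k \<omega> - Y \<omega>\<bar>) \<partial>P)"
  proof (rule nn_integral_cong_AE)
    show "AE \<omega> in P. ennreal \<bar>X \<omega> - Y \<omega>\<bar> = liminf (\<lambda>k. ennreal \<bar>u k \<omega> - Y \<omega>\<bar>)"
      using AE
    proof eventually_elim
      case (elim \<omega>)
      then have "(\<lambda>k. ennreal \<bar>u k \<omega> - Y \<omega>\<bar>) \<longlonglongrightarrow> ennreal \<bar>X \<omega> - Y \<omega>\<bar>"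
        by (intro tendsto_ennrealI tendsto_rabs tendsto_diff tendsto_const)
      then show ?case by (rule lim_imp_Liminf[OF sequentially_bot, symmetric])
    qed
  qed
  also have "\<dots> \<le> liminf (\<lambda>k. \<integral>\<^sup>+\<omega>. ennreal \<bar>u k \<omega> - Y \<omega>\<bar> \<partial>P)"
    by (rule nn_integral_liminf) measurable
  also have "\<dots> \<le> liminf (\<lambda>k. norm1 \<P> (\<lambda>\<omega>. u k \<omega> - Y \<omega>))"
    by (intro Liminf_mono always_eventually allI norm1_upper P)
  also have "\<dots> = 0"
    using lim by (simp add: lim_imp_Liminf)
  finally have "(\<integral>\<^sup>+\<omega>. ennreal \<bar>X \<omega> - Y \<omega>\<bar> \<partial>P) = 0" by simp
  then have "AE \<omega> in P. ennreal \<bar>X \<omega> - Y \<omega>\<bar> = 0"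
    by (subst (asm) nn_integral_0_iff_AE) measurable
  then show ?thesis by eventually_elim simp
qed

lemma martingale_quasi_continuous_version:
  assumes M: "G_martingale T E \<P> M"
  shows "\<exists>N. version_of T \<P> N M \<and> quasi_continuous T \<P> N"
proof -
  have T: "T \<in> {0..T}" using T_pos by simp
  have M_L1G: "M t \<in> L1G T \<P>" if "t \<in> {0..T}" for t
    using M that unfolding G_martingale_def L1G_process_def by blast
  have M_cond: "cond_expectation T E \<P> t (M T) (M t)" if "t \<in> {0..T}" for t
    using M that T unfolding G_martingale_def by simp
  \<comment> \<open>The division by 2 lets two consecutive errors add up to at most (1/4)^k.\<close>
  have "\<exists>Y. lipschitz_cylinder T Y \<and> norm1 \<P> (\<lambda>\<omega>. Y \<omega> - M T \<omega>) \<le> ennreal ((1 / 4) ^ k / 2)" for k :: nat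
    by (rule lipschitz_dense[OF M_L1G[OF T], of "(1 / 4) ^ k / 2"]) auto
  then obtain \<zeta> where \<zeta>: "\<And>k. lipschitz_cylinder T (\<zeta> k)"
    and \<zeta>_M: "\<And>k. norm1 \<P> (\<lambda>\<omega>. \<zeta> k \<omega> - M T \<omega>) \<le> ennreal ((1 / 4) ^ k / 2)"
    by metis
  note \<zeta>_H0 = lipschitz_cylinder_H0[OF \<zeta>]
  define Z where "Z k = (\<lambda>\<omega>. \<bar>\<zeta> (Suc k) \<omega> - \<zeta> k \<omega>\<bar>)" for k
  have Z: "lipschitz_cylinder T (Z k)" for k
    unfolding Z_def by (intro lipschitz_cylinder_abs_diff \<zeta>)
  note Z_H0 = lipschitz_cylinder_H0[OF Z]
  have E_Z: "E (Z k) \<le> (1 / 4) ^ k" for k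
  proof -
    have "ennreal (E (Z k)) = norm1 \<P> (\<lambda>\<omega>. \<zeta> (Suc k) \<omega> - \<zeta> k \<omega>)"
      unfolding Z_def by (intro norm1_H0[symmetric] H_diff \<zeta>_H0)
    also have "\<dots> \<le> norm1 \<P> (\<lambda>\<omega>. \<zeta> (Suc k) \<omega> - M T \<omega>) + norm1 \<P> (\<lambda>\<omega>. M T \<omega> - \<zeta> k \<omega>)"
      by (intro norm1_triangle H0_measurable \<zeta>_H0 L1G_measurable M_L1G T)
    also have "\<dots> \<le> ennreal ((1 / 4) ^ Suc k / 2) + ennreal ((1 / 4) ^ k / 2)"
      unfolding norm1_commute[of "M T"] by (intro add_mono \<zeta>_M)
    also have "\<dots> \<le> ennreal ((1 / 4) ^ k)"
      by (subst ennreal_plus[symmetric]) (auto intro!: ennreal_leI)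
    finally show ?thesis by (simp add: ennreal_le_iff)
  qed
  define Y where "Y k t \<omega> = cexp E t (\<zeta> k) \<omega>" for k t \<omega>
  have Y_cont: "continuous_on (path_space T \<times> {0..T}) (\<lambda>(\<omega>, t). Y k t \<omega>)" for k
    unfolding Y_def by (rule continuous_on_cexp[OF \<zeta>])
  have Y_H0: "Y k t \<in> H0 T" if "t \<in> {0..T}" for k t
    unfolding Y_def[abs_def] by (rule cexp_H0[OF \<zeta>_H0 that])
  \<comment> \<open>Against the expectation (1/4)^k, the threshold (1/2)^k leaves a capacity of at
    most 2 (1/2)^k, and the thresholds are summable themselves.\<close>
  define W where "W k = {\<omega> \<in> path_space T. \<exists>t\<in>{0..T}. (1 / 2) ^ k < cexp E t (Z k) \<omega>}" for k :: nat
  have cont_\<omega>: "continuous_on (path_space T) (cexp E t (Z k))" if "t \<in> {0..T}" for k t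
  proof -
    have "continuous_on (path_space T) (\<lambda>\<omega>. case (\<omega>, t) of (\<omega>, t) \<Rightarrow> cexp E t (Z k) \<omega>)"
      by (rule continuous_on_compose2[OF continuous_on_cexp[OF Z]], intro continuous_on_Pair continuous_on_id continuous_on_const) (use that in auto)
    then show ?thesis by simp
  qed
  have cont_t: "continuous_on {0..T} (\<lambda>t. cexp E t (Z k) \<omega>)" if "\<omega> \<in> path_space T" for k \<omega>
  proof -
    have "continuous_on {0..T} (\<lambda>t. case (\<omega>, t) of (\<omega>, t) \<Rightarrow> cexp E t (Z k) \<omega>)"
      by (rule continuous_on_compose2[OF continuous_on_cexp[OF Z]], intro continuous_on_Pair continuous_on_id continuous_on_const) (use that in auto)
    then show ?thesis by simp
  qed
  have W_open: "openin (top_of_set (path_space T)) (W k)" for k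
  proof -
    \<comment> \<open>Every t contributes a relatively open set, so the uncountable union does no
      harm.\<close>
    have eq: "W k = (\<Union>t\<in>{0..T}. path_space T \<inter> cexp E t (Z k) -` {(1 / 2) ^ k<..})"
      unfolding W_def by auto
    have "openin (top_of_set (path_space T)) (path_space T \<inter> cexp E t (Z k) -` {(1 / 2) ^ k<..})"
      if "t \<in> {0..T}" for t
      using cont_\<omega>[OF that] by (intro continuous_openin_preimage_gen) auto
    then show ?thesis unfolding eq by (intro openin_Union) blast
  qed
  have W_cap: "capacity \<P> (W k) \<le> ennreal (2 * (1 / 2) ^ k)" for k
  proof -
    have "capacity \<P> (W k) \<le> ennreal (2 * E (Z k) / (1 / 2) ^ k)"
      unfolding W_def using cont_t Z_H0 by (intro maximal_inequality) (auto simp: Z_def)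
    also have "2 * E (Z k) / (1 / 2) ^ k \<le> 2 * (1 / 4) ^ k / (1 / 2) ^ k"
      using E_Z by (intro divide_right_mono mult_left_mono) auto
    also have "2 * (1 / 4) ^ k / (1 / 2) ^ k = 2 * ((1 / 4) / (1 / 2) :: real) ^ k"
      by (simp only: power_divide times_divide_eq_right)
    finally show ?thesis by (simp add: ennreal_leI)
  qed
  \<comment> \<open>Outside \<open>U m\<close> all steps from m on are small, uniformly in t; the
    tail of the geometric series bounds its capacity by 4 (1/2)^m.\<close>
  define U where "U m = (\<Union>i. W (i + m))" for m
  have U_open: "openin (top_of_set (path_space T)) (U m)" for m
    unfolding U_def using W_open by (intro openin_Union) auto
  note U_sets = openin_sets_paths[OF U_open]
  have U_cap: "capacity \<P> (U m) \<le> ennreal (4 * (1 / 2) ^ m)" for m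
  proof -
    have "capacity \<P> (U m) \<le> (\<Sum>i. capacity \<P> (W (i + m)))"
      unfolding U_def by (intro capacity_countable_subadditive openin_sets_paths W_open)
    also have "\<dots> \<le> (\<Sum>i. ennreal (2 * (1 / 2) ^ m * (1 / 2) ^ i))"
      using W_cap[of "_ + m"] by (intro suminf_le) (auto simp: power_add mult_ac)
    also have "\<dots> = ennreal (2 * (1 / 2) ^ m * (1 / (1 - 1 / 2)))"
      by (intro suminf_ennreal_eq sums_mult geometric_sums) auto
    finally show ?thesis by simp
  qed
  have Y_step: "\<bar>Y (Suc k) t \<omega> - Y k t \<omega>\<bar> \<le> (1 / 2) ^ k"
    if "\<omega> \<in> path_space T - U m" "t \<in> {0..T}" "m \<le> k" for \<omega> t k m
  proof -
    have "\<omega> \<notin> W k" using that unfolding U_def by (auto dest: le_Suc_ex simp: add.commute)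
    then have "cexp E t (Z k) \<omega> \<le> (1 / 2) ^ k" using that unfolding W_def by force
    moreover have "\<bar>Y (Suc k) t \<omega> - Y k t \<omega>\<bar> \<le> cexp E t (Z k) \<omega>"
      unfolding Y_def Z_def using that by (intro cexp_abs_diff \<zeta>_H0) auto
    ultimately show ?thesis by linarith
  qed
  \<comment> \<open>A path outside V avoids some \<open>U m\<close>, so its approximations converge
    for all t.\<close>
  define V where "V = (\<Inter>m. U m)"
  have V_sets: "V \<in> sets paths"
    unfolding V_def using U_sets by (intro sets.countable_INT) auto
  have V_cap: "capacity \<P> V = 0"
  proof -
    have "(\<lambda>m. 4 * (1 / 2 :: real) ^ m) \<longlonglongrightarrow> 4 * 0"
      by (intro tendsto_mult_left LIMSEQ_power_zero) simp
    then have "(\<lambda>m. ennreal (4 * (1 / 2) ^ m)) \<longlonglongrightarrow> ennreal 0"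
      by (intro tendsto_ennrealI) simp
    moreover have "capacity \<P> V \<le> ennreal (4 * (1 / 2) ^ m)" for m
      using capacity_mono[of V "U m"] U_sets U_cap[of m] unfolding V_def by (meson INT_lower UNIV_I order_trans)
    ultimately have "capacity \<P> V \<le> ennreal 0"
      by (intro LIMSEQ_le_const) auto
    then show ?thesis by simp
  qed
  \<comment> \<open>On the path space the default 0 is taken only on V, a set of capacity zero. It
    makes \<open>N t\<close> the limit at every path of \<open>Y k t\<close> times an indicator,
    hence Borel.\<close>
  define N where "N t \<omega> = (if \<omega> \<in> path_space T - V then lim (\<lambda>k. Y k t \<omega>) else 0)" for t \<omega>
  have N_lim: "(\<lambda>k. Y k t \<omega>) \<longlonglongrightarrow> N t \<omega>" if \<omega>: "\<omega> \<in> path_space T - V" and t: "t \<in> {0..T}" for \<omega> t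
  proof -
    obtain m where m: "\<omega> \<in> path_space T - U m" using \<omega> unfolding V_def by auto
    have "convergent (\<lambda>k. Y k t \<omega>)"
      by (rule geometric_steps_convergent(1)[of m]) (rule Y_step[OF m t])
    then show ?thesis using \<omega> by (simp add: N_def convergent_LIMSEQ_iff)
  qed
  have N_bound: "\<bar>Y k t \<omega> - N t \<omega>\<bar> \<le> 2 * (1 / 2) ^ k"
    if "\<omega> \<in> path_space T - U m" "t \<in> {0..T}" "m \<le> k" for \<omega> t k m
  proof -
    have "\<omega> \<in> path_space T - V" using that unfolding V_def by auto
    then show ?thesis
      using geometric_steps_convergent(2)[of m "\<lambda>k. Y k t \<omega>" k] Y_step[OF that(1,2)] that(3) by (simp add: N_def)
  qed
  \<comment> \<open>\<open>N_bound\<close> is uniform in the pair of path and time, so joint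
    continuity passes to the limit.\<close>
  have N_cont: "continuous_on ((path_space T - U m) \<times> {0..T}) (\<lambda>(\<omega>, t). N t \<omega>)" for m
  proof (rule uniform_limit_theorem)
    show "\<forall>\<^sub>F k in sequentially. continuous_on ((path_space T - U m) \<times> {0..T}) (\<lambda>(\<omega>, t). Y k t \<omega>)"
      by (intro always_eventually allI continuous_on_subset[OF Y_cont]) auto
    show "uniform_limit ((path_space T - U m) \<times> {0..T}) (\<lambda>k (\<omega>, t). Y k t \<omega>) (\<lambda>(\<omega>, t). N t \<omega>) sequentially"
    proof (rule uniform_limitI)
      fix \<epsilon> :: real assume "0 < \<epsilon>"
      have "(\<lambda>k. 2 * (1 / 2 :: real) ^ k) \<longlonglongrightarrow> 2 * 0"
        by (intro tendsto_mult_left LIMSEQ_power_zero) simp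
      then have "\<forall>\<^sub>F k in sequentially. 2 * (1 / 2 :: real) ^ k < \<epsilon>"
        using \<open>0 < \<epsilon>\<close> by (intro order_tendstoD(2)[where y=0]) simp_all
      then show "\<forall>\<^sub>F k in sequentially. \<forall>p\<in>(path_space T - U m) \<times> {0..T}.
          dist (case p of (\<omega>, t) \<Rightarrow> Y k t \<omega>) (case p of (\<omega>, t) \<Rightarrow> N t \<omega>) < \<epsilon>"
        using eventually_ge_at_top[of m]
      proof eventually_elim
        case (elim k)
        then show ?case using N_bound[of _ m _ k] by (fastforce simp: dist_real_def)
      qed
    qed
  qed simp
  have N_meas: "N t \<in> borel_measurable paths" if "t \<in> {0..T}" for t
  proof (rule borel_measurable_LIMSEQ_real)
    show "(\<lambda>\<omega>. indicator (path_space T - V) \<omega> * Y k t \<omega>) \<in> borel_measurable paths" for k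
      using V_sets sets.Diff[OF sets.top V_sets]
      by (intro borel_measurable_times borel_measurable_indicator H0_measurable Y_H0 that) simp
    show "(\<lambda>k. indicator (path_space T - V) \<omega> * Y k t \<omega>) \<longlonglongrightarrow> N t \<omega>" if "\<omega> \<in> space paths" for \<omega>
      using N_lim[OF _ \<open>t \<in> {0..T}\<close>, of \<omega>] that by (cases "\<omega> \<in> V") (simp_all add: N_def)
  qed
  have Y_M: "(\<lambda>k. norm1 \<P> (\<lambda>\<omega>. Y k t \<omega> - M t \<omega>)) \<longlonglongrightarrow> 0" if "t \<in> {0..T}" for t
  proof (rule tendsto_sandwich[OF _ _ tendsto_const])
    have "(\<lambda>k. (1 / 4 :: real) ^ k / 2) \<longlonglongrightarrow> 0 / 2"
      by (intro tendsto_divide LIMSEQ_power_zero tendsto_const) simp_all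
    then have "(\<lambda>k. ennreal ((1 / 4) ^ k / 2)) \<longlonglongrightarrow> ennreal 0"
      by (intro tendsto_ennrealI) simp
    then show "(\<lambda>k. ennreal ((1 / 4) ^ k / 2)) \<longlonglongrightarrow> 0" by simp
    show "\<forall>\<^sub>F k in sequentially. norm1 \<P> (\<lambda>\<omega>. Y k t \<omega> - M t \<omega>) \<le> ennreal ((1 / 4) ^ k / 2)"
      unfolding Y_def
      by (intro always_eventually allI order_trans[OF norm1_cexp_cond_expectation[OF M_cond[OF that] \<zeta>_H0] \<zeta>_M])
  qed simp
  have N_M: "AE \<omega> in P. N t \<omega> = M t \<omega>" if "t \<in> {0..T}" "P \<in> \<P>" for t P
  proof (rule AE_eq_of_norm1[OF _ N_meas L1G_measurable Y_M that(2)])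
    have "emeasure P V \<le> capacity \<P> V" unfolding capacity_def using that by (intro SUP_upper)
    then have "V \<in> null_sets P" using V_cap V_sets repr_sets[OF that(2)] by (intro null_setsI) auto
    then show "AE \<omega> in P. (\<lambda>k. Y k t \<omega>) \<longlonglongrightarrow> N t \<omega>"
      by (rule AE_I') (use N_lim that repr_space in auto)
  qed (use that M_L1G H0_measurable Y_H0 in auto)
  have "version_of T \<P> N M"
    unfolding version_of_def qs_eq_def
  proof
    fix t assume t: "t \<in> {0..T}"
    \<comment> \<open>The exceptional null set of \<open>N_M\<close> may vary with P; the Borel set
      of all points of disagreement is null under each P and serves them all at once.\<close>
    let ?A = "{\<omega> \<in> space paths. N t \<omega> \<noteq> M t \<omega>}"
    have A: "?A \<in> sets paths"
      using N_meas[OF t] L1G_measurable[OF M_L1G[OF t]] by measurable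
    have "emeasure P ?A = 0" if P: "P \<in> \<P>" for P
      using N_M[OF t P] A repr_sets[OF P] repr_space[OF P]
      by (subst (asm) AE_iff_measurable[of ?A]) auto
    then have "capacity \<P> ?A \<le> 0" unfolding capacity_def by (intro SUP_least) simp
    then have "capacity \<P> ?A = 0" by simp
    then show "\<exists>A\<in>sets paths. capacity \<P> A = 0 \<and> (\<forall>\<omega>\<in>path_space T - A. N t \<omega> = M t \<omega>)"
      using A by (intro bexI[of _ ?A]) auto
  qed
  moreover have "quasi_continuous T \<P> N"
    unfolding quasi_continuous_def
  proof (intro conjI allI impI)
    show "L1G_process T \<P> N"
      unfolding L1G_process_def
    proof
      fix t assume t: "t \<in> {0..T}"
      \<comment> \<open>\<open>norm1\<close> does not distinguish \<open>N t\<close> from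
        \<open>M t\<close>, so the cylinder functions that approach \<open>M t\<close> approach
        \<open>N t\<close> as well.\<close>
      have "norm1 \<P> (\<lambda>\<omega>. Y k t \<omega> - N t \<omega>) = norm1 \<P> (\<lambda>\<omega>. Y k t \<omega> - M t \<omega>)" for k
        unfolding norm1_def
      proof (intro SUP_cong refl nn_integral_cong_AE)
        fix P assume "P \<in> \<P>"
        from N_M[OF t this] show "AE \<omega> in P. ennreal \<bar>Y k t \<omega> - N t \<omega>\<bar> = ennreal \<bar>Y k t \<omega> - M t \<omega>\<bar>"
          by eventually_elim simp
      qed
      then show "N t \<in> L1G T \<P>"
        unfolding L1G_def using N_meas[OF t] Y_H0[OF t] Y_M[OF t]
        by (intro CollectI conjI exI[of _ "\<lambda>k. Y k t"]) auto
    qed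
    fix \<epsilon> :: real assume "0 < \<epsilon>"
    have "(\<lambda>m. 4 * (1 / 2 :: real) ^ m) \<longlonglongrightarrow> 4 * 0"
      by (intro tendsto_mult_left LIMSEQ_power_zero) simp
    then have "\<forall>\<^sub>F m in sequentially. 4 * (1 / 2 :: real) ^ m < \<epsilon>"
      using \<open>0 < \<epsilon>\<close> by (intro order_tendstoD(2)[where y=0]) simp_all
    then obtain m where m: "4 * (1 / 2 :: real) ^ m < \<epsilon>" by (auto simp: eventually_sequentially)
    have "capacity \<P> (U m) < ennreal \<epsilon>"
      using U_cap[of m] m \<open>0 < \<epsilon>\<close> by (meson ennreal_lessI le_less_trans)
    then show "\<exists>U. openin (top_of_set (path_space T)) U \<and> capacity \<P> U < ennreal \<epsilon> \<and>
      continuous_on ((path_space T - U) \<times> {0..T}) (\<lambda>(\<omega>, t). N t \<omega>)"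
      using U_open N_cont by blast
  qed
  ultimately show ?thesis by blast
qed

end

theorem theorem5p3:
  fixes \<Omega>' :: "'w set"
    and H' :: "('w \<Rightarrow> real) set"
    and E' :: "('w \<Rightarrow> real) \<Rightarrow> real"
    and G :: "real ^ 'd ^ 'd \<Rightarrow> real"
    and \<xi> :: "nat \<Rightarrow> 'w \<Rightarrow> real ^ 'd::finite"
    and T :: real
    and E :: "('d path \<Rightarrow> real) \<Rightarrow> real"
    and \<P> :: "'d path measure set"
    and M :: "real \<Rightarrow> 'd path \<Rightarrow> real"
  assumes "sublinear_expectation \<Omega>' H' E'"
    and "iid_G_normal_sequence H' E' G \<xi>"
    and "nondegenerate G"
    and "T > 0"
    and "G_expectation H' E' \<xi> T E"
    and "represents T \<P> E"
    and "G_martingale T E \<P> M"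
  shows "\<exists>N. version_of T \<P> N M \<and> quasi_continuous T \<P> N"
proof -
  interpret G_space_repr \<Omega>' H' E' G \<xi> T E \<P>
    by unfold_locales (use assms in auto)
  show ?thesis by (rule martingale_quasi_continuous_version[OF assms(7)])
qed

end
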